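(* Let $d\in\{1,2,3,4,7\}$. Define the set of primes $Q_d$ and the finite set of primes $R_d$ by: $d=1$: $Q_1=\{p\equiv3 \ (4)\}$, $R_1=\{2\}$; $d=2$: $Q_2=\{p\equiv5,7\ (8)\}$, $R_2=\{2\}$; $d=3$: $Q_3=\{p\equiv2\ (3)\}$ (including $p=2$), $R_3=\{3\}$; $d=4$: $Q_4=\{p\equiv3\ (4)\}$, $R_4=\{2\}$; $d=7$: $Q_7=\{p\equiv3,5,6\ (7)\}$, $R_7=\{2,7\}$. For $p\in R_d$ let $w_d(p)=\lim_{k\to\infty}p^{-k}\#\{a\in\mathbb{Z}/p^k\mathbb{Z}: a\equiv x^2+dy^2 \pmod{p^k}\text{ for some }x,y\in\mathbb{Z}\}$. Define $$\mathcal{M}_d(n)=\prod_{p\in R_d}w_d(p)\prod_{\substack{p\in Q_d\\ p\le n}}(1+p^{-1})^{-1},\qquad \mathcal{L}_d(n)=\frac{\beta_d}{\sqrt{\log n}},$$ where $$\beta_d=\delta_d\, g_d\left(\frac{2|d|\,L_d(1)}{\pi\,\varphi(2|d|)}\right)^{1/2},\quad g_d=\prod_{\substack{p\in Q_d\\ p\ \mathrm{odd}}}(1-p^{-2})^{-1/2},\quad \delta_1=\delta_2=1,\ \delta_3=\tfrac23,\ \delta_4=\delta_7=\tfrac34,$$ $\varphi$ is Euler's totient function, and $L_d(1)=\sum_{n\ \mathrm{odd}}\left(\frac{-d}{n}\right)n^{-1}$ (Jacobi symbol), which equals $\frac{\pi}{4},\frac{\pi}{2\sqrt2},\frac{\pi}{2\sqrt3},\frac{\pi}{4},\frac{\pi}{2\sqrt7}$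 for $d=1,2,3,4,7$ respectively. Then $$\lim_{n\to\infty}\frac{\mathcal{M}_d(n)}{\mathcal{L}_d(n)}=\frac12\sqrt{\frac{\pi}{e^{\gamma}}}$$ for each $d\in\{1,2,3,4,7\}$, where $\gamma$ is Euler's constant.
   Context: $p$ ranges over primes. The constants $\beta_d$ are the constants (due to Shanks/Landau) for which the number of $m\le n$ of the form $x^2+dy^2$ is asymptotic to $\beta_d n/\sqrt{\log n}$. An integer is of the form $x^2+dy^2$ iff primes in $Q_d$ occur to even exponent, with additionally $m_2(n)\ne1$ for $d=4,7$. *)

theory Defs
  imports "HOL-Analysis.Analysis" "HOL-Number_Theory.Number_Theory"
begin

definition inQ :: "nat \<Rightarrow> nat \<Rightarrow> bool" where
  "inQ d p \<longleftrightarrow> prime p \<and>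
     (if d = 1 then p mod 4 = 3
      else if d = 2 then p mod 8 \<in> {5, 7}
      else if d = 3 then p mod 3 = 2
      else if d = 4 then p mod 4 = 3
      else if d = 7 then p mod 7 \<in> {3, 5, 6}
      else False)"

definition Rset :: "nat \<Rightarrow> nat set" where
  "Rset d = (if d = 3 then {3} else if d = 7 then {2, 7} else {2})"

definition wdens :: "nat \<Rightarrow> nat \<Rightarrow> real" where
  "wdens d p = lim (\<lambda>k. real (card {a \<in> {0..<p ^ k}.
       \<exists>x y :: int. [int a = x^2 + int d * y^2] (mod int (p ^ k))}) / real p ^ k)"

definition Mfun :: "nat \<Rightarrow> nat \<Rightarrow> real" where
  "Mfun d n = (\<Prod>p\<in>Rset d. wdens d p) *
              (\<Prod>p\<in>{p. inQ d p \<and> p \<le> n}. inverse (1 + inverse (real p)))"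

definition Jacobi :: "int \<Rightarrow> nat \<Rightarrow> int" where
  "Jacobi a n = (\<Prod>p\<in>prime_factors n. Legendre a (int p) ^ multiplicity p n)"

definition Lval :: "nat \<Rightarrow> real" where
  "Lval d = (\<Sum>n. if odd n then real_of_int (Jacobi (- int d) n) / real n else 0)"

definition gconst :: "nat \<Rightarrow> real" where
  "gconst d = prodinf (\<lambda>p. if inQ d p \<and> odd p then (1 - inverse (real p ^ 2)) powr (-1/2) else 1)"

definition delta :: "nat \<Rightarrow> real" where
  "delta d = (if d = 1 \<or> d = 2 then 1 else if d = 3 then 2/3 else 3/4)"

definition beta :: "nat \<Rightarrow> real" where
  "beta d = delta d * gconst d *
     sqrt (2 * real d * Lval d / (pi * real (totient (2 * d))))"

definition Lfun :: "nat \<Rightarrow> nat \<Rightarrow> real" where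
  "Lfun d n = beta d / sqrt (ln (real n))"

end

theory Submission
  imports Defs "HOL-Real_Asymp.Real_Asymp"
begin

text \<open>Write \<open>\<chi>(n) = (-d/n)\<close> for odd \<open>n\<close> and \<open>0\<close> for even \<open>n\<close>. For odd primes, \<open>Q\<^sub>d\<close> is the set where
  \<open>\<chi>(p) = -1\<close>, and for such \<open>p\<close> one has \<open>(1 - 1/p) / (1 - \<chi>(p)/p) = (1 + 1/p)\<^sup>-\<^sup>2 (1 - p\<^sup>-\<^sup>2)\<close>,
  while the quotient is \<open>1\<close> if \<open>\<chi>(p) = 1\<close> and \<open>1 - 1/p\<close> if \<open>p\<close> divides \<open>2d\<close>. Hence the square of the product over
  \<open>Q\<^sub>d\<close> is, up to \<open>g\<^sub>d\<close> and \<open>\<phi>(2d)/2d\<close>, the quotient of Mertens' product, which is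
  \<open>\<sim> exp(-\<gamma>) / log n\<close>, by the partial Euler product of \<open>L(1, \<chi>)\<close>, which tends to \<open>1/L(1, \<chi>)\<close>.

  Both asymptotics are instances of one statement about a bounded completely multiplicative \<open>f\<close> whose sum of
  \<open>f(p) log p / p\<close> over \<open>p \<le> n\<close> is \<open>\<kappa> log n + O(1)\<close>. The constant is found by letting \<open>s \<rightarrow> 0\<close> in
  the Dirichlet series at \<open>1 + s\<close>; Euler's constant enters by comparing the primes with the series with
  coefficient \<open>1/m\<close> at \<open>\<lceil>exp m\<rceil>\<close>, whose partial sums are harmonic numbers and whose sum at \<open>s\<close> is
  \<open>-log s + o(1)\<close>. For \<open>d = 1\<close> and for \<open>p = d\<close>, the density \<open>u(k)\<close> modulo
  \<open>p\<^sup>k\<close> satisfies \<open>u(k+1) = \<alpha> + u(k)/p\<close>, because a multiple of \<open>p\<close> is represented exactly if its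
  quotient by \<open>p\<close> is, and units are handled by lifting square roots; \<open>d = 4\<close> reduces to \<open>d = 1\<close>, and for
  \<open>d = 7\<close>, \<open>p = 2\<close> the form splits into linear factors.\<close>

section \<open>Summation by parts\<close>

text \<open>Partial summation writes the weighted sum as a combination of partial sums of
  \<open>a\<close> with the nonnegative coefficients \<open>w k - w (Suc k)\<close> and the last
  weight. These coefficients telescope to \<open>w 0\<close>.\<close>

lemma abel_inequality:
  fixes a w :: "nat \<Rightarrow> real"
  assumes bound: "\<And>n. \<bar>\<Sum>k<n. a k\<bar> \<le> B"
    and nonneg: "\<And>k. 0 \<le> w k" and decr: "\<And>k. w (Suc k) \<le> w k"
  shows "\<bar>\<Sum>k<n. a k * w k\<bar> \<le> B * w 0"
proof (cases n)
  case 0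
  have "0 \<le> B" using bound[of 0] by simp
  with 0 nonneg show ?thesis by simp
next
  case (Suc m)
  have parts: "(\<Sum>k<Suc m. a k * w k) =
      (\<Sum>k<Suc m. a k) * w m + (\<Sum>k<m. (\<Sum>j<Suc k. a j) * (w k - w (Suc k)))" for m
    by (induction m) (simp_all add: algebra_simps)
  have tele: "(\<Sum>k<m. B * (w k - w (Suc k))) = B * (w 0 - w m)"
    by (simp add: sum_distrib_left[symmetric] sum_lessThan_telescope')
  have "\<bar>\<Sum>k<Suc m. a k * w k\<bar> \<le> \<bar>(\<Sum>k<Suc m. a k) * w m\<bar>
      + (\<Sum>k<m. \<bar>(\<Sum>j<Suc k. a j) * (w k - w (Suc k))\<bar>)"
    unfolding parts by (intro order_trans[OF abs_triangle_ineq] add_left_mono sum_abs)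
  also have "\<dots> \<le> B * w m + (\<Sum>k<m. B * (w k - w (Suc k)))"
    unfolding abs_mult using nonneg decr
    by (intro add_mono sum_mono mult_mono bound) (auto intro: order_trans[OF abs_ge_zero bound])
  also have "\<dots> = B * w 0" unfolding tele by (simp add: algebra_simps)
  finally show ?thesis using Suc by simp
qed

lemma abel_inequality_atLeastLessThan:
  fixes a w :: "nat \<Rightarrow> real"
  assumes bound: "\<And>n. \<bar>\<Sum>k\<in>{m..<n}. a k\<bar> \<le> B"
    and nonneg: "\<And>k. k \<ge> m \<Longrightarrow> 0 \<le> w k" and decr: "\<And>k. k \<ge> m \<Longrightarrow> w (Suc k) \<le> w k"
  shows "\<bar>\<Sum>k\<in>{m..<n}. a k * w k\<bar> \<le> B * w m"
proof (cases "m \<le> n")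
  case True
  have shift: "(\<Sum>k\<in>{m..<m+j}. g k) = (\<Sum>k<j. g (k + m))" for g :: "nat \<Rightarrow> real" and j
    using sum.shift_bounds_nat_ivl[of g 0 m j] by (simp add: lessThan_atLeast0 add.commute)
  have "\<bar>\<Sum>k<n-m. a (k+m) * w (k+m)\<bar> \<le> B * w (0+m)"
    using nonneg decr by (intro abel_inequality) (auto simp: shift[symmetric] bound)
  with True show ?thesis using shift[of "\<lambda>k. a k * w k" "n - m"] by simp
next
  case False
  have "0 \<le> B" using bound[of m] by simp
  with False nonneg show ?thesis by simp
qed

lemma abs_sum_atLeastLessThan_le:
  fixes a :: "nat \<Rightarrow> real"
  assumes "\<And>n. \<bar>\<Sum>k<n. a k\<bar> \<le> B"
  shows "\<bar>\<Sum>k\<in>{m..<n}. a k\<bar> \<le> 2 * B"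
proof (cases "m \<le> n")
  case True
  then have "(\<Sum>k\<in>{m..<n}. a k) = (\<Sum>k<n. a k) - (\<Sum>k<m. a k)"
    by (simp add: lessThan_atLeast0 sum_diff_nat_ivl)
  then show ?thesis using assms[of m] assms[of n] by linarith
next
  case False
  then show ?thesis using assms[of 0] by simp
qed

lemma abs_suminf_diff_le:
  fixes f :: "nat \<Rightarrow> real"
  assumes "summable f" and "\<And>n. n \<ge> m \<Longrightarrow> \<bar>\<Sum>k\<in>{m..<n}. f k\<bar> \<le> e"
  shows "\<bar>suminf f - (\<Sum>k<m. f k)\<bar> \<le> e"
proof -
  have lim: "(\<lambda>n. \<bar>(\<Sum>k<n. f k) - (\<Sum>k<m. f k)\<bar>) \<longlonglongrightarrow> \<bar>suminf f - (\<Sum>k<m. f k)\<bar>"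
    by (intro tendsto_intros summable_LIMSEQ assms)
  have "\<bar>(\<Sum>k<n. f k) - (\<Sum>k<m. f k)\<bar> \<le> e" if "n \<ge> m" for n
  proof -
    from that have "(\<Sum>k<n. f k) - (\<Sum>k<m. f k) = (\<Sum>k\<in>{m..<n}. f k)"
      by (simp add: lessThan_atLeast0 sum_diff_nat_ivl)
    with assms(2)[OF that] show ?thesis by simp
  qed
  with lim show ?thesis by (intro LIMSEQ_le_const2) auto
qed

text \<open>Dirichlet's test with an explicit tail bound. The threshold \<open>K\<close> admits
  weights such as 1 / ln k and ln k / k, which decrease only from some index on. The factor 2 arises
  because a sum over a window is a difference of two partial sums.\<close>

lemma dirichlet_test:
  fixes a w :: "nat \<Rightarrow> real"
  assumes bound: "\<And>n. \<bar>\<Sum>k<n. a k\<bar> \<le> B"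
    and nonneg: "\<And>k. k \<ge> K \<Longrightarrow> 0 \<le> w k" and decr: "\<And>k. k \<ge> K \<Longrightarrow> w (Suc k) \<le> w k"
    and lim: "w \<longlonglongrightarrow> 0"
  shows "summable (\<lambda>k. a k * w k)"
    and "m \<ge> K \<Longrightarrow> \<bar>(\<Sum>k. a k * w k) - (\<Sum>k<m. a k * w k)\<bar> \<le> 2 * B * w m"
proof -
  have part: "\<bar>\<Sum>k\<in>{m..<n}. a k * w k\<bar> \<le> 2 * B * w m" if "m \<ge> K" for m n
    using that nonneg decr
    by (intro abel_inequality_atLeastLessThan abs_sum_atLeastLessThan_le bound) auto
  have w2: "(\<lambda>m. 2 * B * w m) \<longlonglongrightarrow> 0"
    using tendsto_mult_left[OF lim, of "2 * B"] by simp
  show sm: "summable (\<lambda>k. a k * w k)"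
    unfolding summable_Cauchy
  proof (intro allI impI)
    fix e :: real assume "e > 0"
    from order_tendstoD(2)[OF w2 this] obtain N where N: "\<And>m. m \<ge> N \<Longrightarrow> 2 * B * w m < e"
      by (auto simp: eventually_at_top_linorder)
    show "\<exists>N. \<forall>m\<ge>N. \<forall>n. norm (\<Sum>k\<in>{m..<n}. a k * w k) < e"
      using part N by (intro exI[of _ "max N K"]) (auto intro: le_less_trans)
  qed
  show "\<bar>(\<Sum>k. a k * w k) - (\<Sum>k<m. a k * w k)\<bar> \<le> 2 * B * w m" if "m \<ge> K"
    using that by (intro abs_suminf_diff_le sm part)
qed

text \<open>An abstract form of Abel's limit theorem: partial summation carries the Cauchy estimate
  for \<open>a\<close> over to the weighted series uniformly in \<open>s\<close>, and the remaining
  finite initial sum converges term by term.\<close>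

lemma abel_limit:
  fixes a :: "nat \<Rightarrow> real" and w :: "'b \<Rightarrow> nat \<Rightarrow> real"
  assumes a: "summable a"
    and w: "eventually (\<lambda>s. \<forall>k. 0 \<le> w s k \<and> w s (Suc k) \<le> w s k \<and> w s k \<le> 1) F"
    and lim: "\<And>k. ((\<lambda>s. w s k) \<longlongrightarrow> 1) F"
  shows "((\<lambda>s. \<Sum>k. a k * w s k) \<longlongrightarrow> suminf a) F"
proof (rule tendstoI)
  fix e :: real assume "e > 0"
  then have e4: "e / 4 > 0" by simp
  from a[unfolded summable_Cauchy, rule_format, OF e4]
  obtain K where K: "\<And>m n. m \<ge> K \<Longrightarrow> \<bar>\<Sum>k\<in>{m..<n}. a k\<bar> < e / 4" by auto
  have "((\<lambda>s. \<Sum>k<K. a k * w s k) \<longlongrightarrow> (\<Sum>k<K. a k * 1)) F"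
    by (intro tendsto_intros lim)
  from tendstoD[OF this e4]
  have "eventually (\<lambda>s. \<bar>(\<Sum>k<K. a k * w s k) - (\<Sum>k<K. a k)\<bar> < e / 4) F"
    by (simp add: dist_real_def)
  then show "eventually (\<lambda>s. dist (\<Sum>k. a k * w s k) (suminf a) < e) F"
    using w
  proof eventually_elim
    case (elim s)
    \<comment> \<open>The bound does not involve \<open>s\<close>. It is kept general in
      \<open>c\<close> and \<open>K'\<close> because it serves twice: for summability at fixed
      \<open>s\<close>, and for the tail beyond \<open>K\<close>.\<close>
    have part: "\<bar>\<Sum>k\<in>{m..<n}. a k * w s k\<bar> \<le> c"
      if "m \<ge> K'" "\<And>m n. m \<ge> K' \<Longrightarrow> \<bar>\<Sum>k\<in>{m..<n}. a k\<bar> < c" for m n c K'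
    proof -
      have "0 < c" using that(2)[of K' K'] by simp
      have "\<bar>\<Sum>k\<in>{m..<n}. a k * w s k\<bar> \<le> c * w s m"
        using elim that by (intro abel_inequality_atLeastLessThan) (auto intro: less_imp_le)
      also have "\<dots> \<le> c" using elim \<open>0 < c\<close> by (simp add: mult_left_le)
      finally show ?thesis .
    qed
    have "summable (\<lambda>k. a k * w s k)"
      unfolding summable_Cauchy
    proof (intro allI impI)
      fix r :: real assume "r > 0"
      then have "r / 2 > 0" by simp
      from a[unfolded summable_Cauchy, rule_format, OF this]
      obtain K' where K': "\<And>m n. m \<ge> K' \<Longrightarrow> \<bar>\<Sum>k\<in>{m..<n}. a k\<bar> < r / 2" by auto
      have "norm (\<Sum>k\<in>{m..<n}. a k * w s k) < r" if "m \<ge> K'" for m n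
        using part[OF that K', of n] \<open>r > 0\<close> by simp
      then show "\<exists>N. \<forall>m\<ge>N. \<forall>n. norm (\<Sum>k\<in>{m..<n}. a k * w s k) < r" by blast
    qed
    then have "\<bar>(\<Sum>k. a k * w s k) - (\<Sum>k<K. a k * w s k)\<bar> \<le> e / 4"
      using K by (intro abs_suminf_diff_le part[where K' = K]) auto
    moreover have "\<bar>suminf a - (\<Sum>k<K. a k)\<bar> \<le> e / 4"
      using K by (intro abs_suminf_diff_le a) (auto intro: less_imp_le)
    ultimately show ?case using elim(1) \<open>e > 0\<close> unfolding dist_real_def by linarith
  qed
qed

section \<open>Euler products\<close>

text \<open>The sieve of Eratosthenes: the multiples of p among the numbers that survive
  \<open>P\<close> are p times those survivors, so by multiplicativity each further prime multiplies
  the sum by \<open>1 - g p\<close>. Unordered sums make the splitting of the index set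
  legitimate.\<close>

lemma infsum_sieve:
  fixes g :: "nat \<Rightarrow> real"
  assumes g_mult: "\<And>m n. g (m * n) = g m * g n"
    and g_abs: "summable (\<lambda>n. \<bar>g n\<bar>)" and "finite P" and "\<And>p. p \<in> P \<Longrightarrow> prime p"
  shows "infsum g {n. 0 < n \<and> (\<forall>p\<in>P. \<not> p dvd n)} = infsum g {0<..} * (\<Prod>p\<in>P. 1 - g p)"
  using assms(3,4)
proof (induction P rule: finite_induct)
  case empty
  then show ?case by (simp add: greaterThan_def)
next
  case (insert p P)
  define A where "A P = {n. 0 < n \<and> (\<forall>p\<in>P. \<not> p dvd n)}" for P :: "nat set"
  have summ: "g summable_on X" for X
    using norm_summable_imp_summable_on[of g] g_abs summable_on_subset_banach by auto
  have p: "prime p" and P: "\<And>q. q \<in> P \<Longrightarrow> prime q" using insert.prems by auto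
  then have "p > 0" by (simp add: prime_gt_0_nat)
  have split: "A P = A (insert p P) \<union> (\<lambda>m. p * m) ` A P"
  proof (intro equalityI subsetI)
    fix n assume n: "n \<in> A P"
    show "n \<in> A (insert p P) \<union> (\<lambda>m. p * m) ` A P"
    proof (cases "p dvd n")
      case True
      then obtain m where "n = p * m" by blast
      with n have "m \<in> A P" by (auto simp: A_def)
      with \<open>n = p * m\<close> show ?thesis by blast
    qed (use n in \<open>auto simp: A_def\<close>)
  next
    fix n assume "n \<in> A (insert p P) \<union> (\<lambda>m. p * m) ` A P"
    then show "n \<in> A P"
    proof
      assume "n \<in> (\<lambda>m. p * m) ` A P"
      then obtain m where m: "m \<in> A P" "n = p * m" by blast
      have "\<not> q dvd p * m" if "q \<in> P" for q
        using that m P[OF that] p insert.hyps by (auto simp: A_def prime_dvd_mult_iff dest: primes_dvd_imp_eq)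
      with m \<open>p > 0\<close> show ?thesis by (auto simp: A_def)
    qed (auto simp: A_def)
  qed
  have "infsum g (A (insert p P) \<union> (\<lambda>m. p * m) ` A P)
      = infsum g (A (insert p P)) + infsum g ((\<lambda>m. p * m) ` A P)"
    by (rule infsum_Un_disjoint) (auto simp: summ A_def)
  then have "infsum g (A P) = infsum g (A (insert p P)) + infsum g ((\<lambda>m. p * m) ` A P)"
    by (simp only: split[symmetric])
  also have "infsum g ((\<lambda>m. p * m) ` A P) = g p * infsum g (A P)"
    using \<open>p > 0\<close> by (subst infsum_reindex) (simp_all add: o_def g_mult infsum_cmult_right' inj_on_def)
  finally have "infsum g (A (insert p P)) = infsum g (A P) - g p * infsum g (A P)"
    by linarith
  moreover have "infsum g (A P) = infsum g {0<..} * (\<Prod>p\<in>P. 1 - g p)"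
    unfolding A_def using P by (rule insert.IH)
  ultimately show ?case using insert.hyps by (simp add: A_def algebra_simps)
qed

text \<open>After sieving by all primes up to N, only 1 and numbers greater than N survive. The
  error is therefore at most the tail of the absolutely convergent series.\<close>

lemma euler_product_tendsto:
  fixes g :: "nat \<Rightarrow> real"
  assumes g_mult: "\<And>m n. g (m * n) = g m * g n" and g0: "g 0 = 0" and g1: "g 1 = 1"
    and g_abs: "summable (\<lambda>n. \<bar>g n\<bar>)"
  shows "(\<lambda>N. suminf g * (\<Prod>p\<in>{p. prime p \<and> p \<le> N}. 1 - g p)) \<longlonglongrightarrow> 1"
proof -
  have summ: "g summable_on X" "(\<lambda>n. \<bar>g n\<bar>) summable_on X" for X
    using norm_summable_imp_summable_on[of g] norm_summable_imp_summable_on[of "\<lambda>n. \<bar>g n\<bar>"] 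
      g_abs summable_on_subset_banach by auto
  have "g sums infsum g UNIV" using summ by (intro has_sum_imp_sums) simp
  then have "suminf g = infsum g UNIV" by (simp add: sums_iff)
  also have "\<dots> = infsum g {0<..}" by (rule infsum_cong_neutral) (auto simp: g0)
  finally have Z: "suminf g = infsum g {0<..}" .
  have "(\<lambda>n. \<bar>g n\<bar>) sums infsum (\<lambda>n. \<bar>g n\<bar>) UNIV" using summ by (intro has_sum_imp_sums) simp
  then have Zabs: "suminf (\<lambda>n. \<bar>g n\<bar>) = infsum (\<lambda>n. \<bar>g n\<bar>) UNIV" by (simp add: sums_iff)
  have bound: "\<bar>suminf g * (\<Prod>p\<in>{p. prime p \<and> p \<le> N}. 1 - g p) - 1\<bar>
      \<le> suminf (\<lambda>n. \<bar>g n\<bar>) - (\<Sum>n\<le>N. \<bar>g n\<bar>)" for N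
  proof -
    define C where "C = {n. 0 < n \<and> (\<forall>p\<in>{p. prime p \<and> p \<le> N}. \<not> p dvd n)}"
    have C: "C = insert 1 (C - {1})" by (auto simp: C_def)
    have CN: "C - {1} \<subseteq> {N<..}"
    proof
      fix n assume n: "n \<in> C - {1}"
      then obtain p where p: "prime p" "p dvd n" using prime_factor_nat[of n] by auto
      with n have "N < p" by (auto simp: C_def)
      also have "p \<le> n" using p n by (auto simp: C_def intro: dvd_imp_le)
      finally show "n \<in> {N<..}" by simp
    qed
    have "suminf g * (\<Prod>p\<in>{p. prime p \<and> p \<le> N}. 1 - g p) = infsum g C"
      unfolding Z C_def by (rule infsum_sieve[symmetric]) (auto simp: g_mult g_abs)
    also have "\<dots> = 1 + infsum g (C - {1})"
      by (subst C, subst infsum_insert) (auto simp: summ g1[simplified])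
    finally have "\<bar>suminf g * (\<Prod>p\<in>{p. prime p \<and> p \<le> N}. 1 - g p) - 1\<bar> = \<bar>infsum g (C - {1})\<bar>"
      by simp
    also have "\<dots> \<le> infsum (\<lambda>n. \<bar>g n\<bar>) (C - {1})"
      using norm_infsum_bound[of g "C - {1}"] summ by simp
    also have "\<dots> \<le> infsum (\<lambda>n. \<bar>g n\<bar>) {N<..}"
      using CN by (intro infsum_mono2 summ) auto
    also have "\<dots> = suminf (\<lambda>n. \<bar>g n\<bar>) - (\<Sum>n\<le>N. \<bar>g n\<bar>)"
    proof -
      have "infsum (\<lambda>n. \<bar>g n\<bar>) ({..N} \<union> {N<..}) = (\<Sum>n\<le>N. \<bar>g n\<bar>) + infsum (\<lambda>n. \<bar>g n\<bar>) {N<..}"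
        by (subst infsum_Un_disjoint) (auto simp: summ)
      moreover have "{..N} \<union> {N<..} = (UNIV :: nat set)" by auto
      ultimately show ?thesis unfolding Zabs by simp
    qed
    finally show ?thesis .
  qed
  have "(\<lambda>N. suminf (\<lambda>n. \<bar>g n\<bar>) - (\<Sum>n\<le>N. \<bar>g n\<bar>)) \<longlonglongrightarrow> suminf (\<lambda>n. \<bar>g n\<bar>) - suminf (\<lambda>n. \<bar>g n\<bar>)"
    by (intro tendsto_intros summable_LIMSEQ' g_abs)
  then have lim: "(\<lambda>N. suminf (\<lambda>n. \<bar>g n\<bar>) - (\<Sum>n\<le>N. \<bar>g n\<bar>)) \<longlonglongrightarrow> 0" by simp
  have "(\<lambda>N. suminf g * (\<Prod>p\<in>{p. prime p \<and> p \<le> N}. 1 - g p) - 1) \<longlonglongrightarrow> 0"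
    by (rule Lim_null_comparison[OF _ lim]) (use bound in auto)
  then show ?thesis by (simp add: LIM_zero_iff)
qed

text \<open>The finite products are positive and their product with \<open>suminf g\<close> tends to
  1, which forces \<open>suminf g\<close> to be positive. Taking logarithms then turns the product
  into a series over primes.\<close>

lemma ln_euler_product_sums:
  fixes g :: "nat \<Rightarrow> real"
  assumes g_mult: "\<And>m n. g (m * n) = g m * g n" and g0: "g 0 = 0" and g1: "g 1 = 1"
    and g_abs: "summable (\<lambda>n. \<bar>g n\<bar>)" and g_less: "\<And>p. prime p \<Longrightarrow> g p < 1"
  shows "suminf g > 0" and "(\<lambda>n. if prime n then - ln (1 - g n) else 0) sums ln (suminf g)"
proof -
  define Q where "Q N = (\<Prod>p\<in>{p. prime p \<and> p \<le> N}. 1 - g p)" for N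
  have lim: "(\<lambda>N. suminf g * Q N) \<longlonglongrightarrow> 1"
    unfolding Q_def by (rule euler_product_tendsto) fact+
  have Qpos: "Q N > 0" for N
    unfolding Q_def using g_less by (intro prod_pos) auto
  have "eventually (\<lambda>N. 0 < suminf g * Q N) sequentially"
    using order_tendstoD(1)[OF lim, of 0] by simp
  then obtain N where "0 < suminf g * Q N" by (auto simp: eventually_at_top_linorder)
  with Qpos[of N] show Z: "suminf g > 0" by (simp add: zero_less_mult_iff)
  have "(\<lambda>N. ln (suminf g) - ln (suminf g * Q N)) \<longlonglongrightarrow> ln (suminf g) - ln 1"
    by (intro tendsto_intros lim) auto
  moreover have "ln (suminf g) - ln (suminf g * Q N) = (\<Sum>n\<le>N. if prime n then - ln (1 - g n) else 0)" for N
  proof -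
    have "ln (suminf g) - ln (suminf g * Q N) = - ln (Q N)"
      using Z Qpos[of N] by (simp add: ln_mult)
    also have "ln (Q N) = (\<Sum>p\<in>{p. prime p \<and> p \<le> N}. ln (1 - g p))"
      unfolding Q_def by (intro ln_prod) (auto dest: g_less)
    also have "{p. prime p \<and> p \<le> N} = {n\<in>{..N}. prime n}" by auto
    finally show ?thesis by (subst sum.inter_filter[symmetric]) (simp_all add: sum_negf)
  qed
  ultimately show "(\<lambda>n. if prime n then - ln (1 - g n) else 0) sums ln (suminf g)"
    by (simp add: sums_def_le)
qed

section \<open>The harmonic numbers as a comparison series\<close>

lemma ln_less_iff: "0 < x \<Longrightarrow> ln x < y \<longleftrightarrow> x < exp (y :: real)"
  by (simp add: ln_ge_iff not_le[symmetric])

text \<open>The coefficients of the comparison series, given as differences of the wanted partial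
  sums. The partial sums then telescope, and the positions and sizes of the nonzero coefficients are
  derived afterwards.\<close>

definition harm_jump :: "nat \<Rightarrow> real" where
  "harm_jump n = harm (nat \<lfloor>ln (real n)\<rfloor>) - harm (nat \<lfloor>ln (real (n - 1))\<rfloor>)"

definition jump_pos :: "nat \<Rightarrow> nat" where
  "jump_pos m = nat \<lceil>exp (real (Suc m))\<rceil>"

lemma sum_harm_jump: "(\<Sum>k\<le>N. harm_jump k) = harm (nat \<lfloor>ln (real N)\<rfloor>)"
  by (induction N) (simp_all add: harm_jump_def harm_expand)

text \<open>Consecutive powers of e are at least 1 apart. Hence their ceilings are distinct, and the
  floor of ln n never rises by two between neighbouring integers.\<close>

lemma exp_Suc_gap: "exp (real m) + 1 \<le> exp (real (Suc m))"
proof -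
  have "exp (real m) * 2 \<le> exp (real m) * exp 1"
    using exp_ge_add_one_self[of 1] by (intro mult_left_mono) auto
  moreover have "1 \<le> exp (real m)" by simp
  ultimately have "exp (real m) + 1 \<le> exp (real m) * exp 1" by linarith
  then show ?thesis by (simp add: exp_add algebra_simps)
qed

lemma jump_pos_bounds:
  "exp (real (Suc m)) \<le> real (jump_pos m)" "real (jump_pos m) < exp (real (Suc m)) + 1"
proof -
  have *: "real (jump_pos m) = of_int \<lceil>exp (real (Suc m))\<rceil>"
    unfolding jump_pos_def by (rule of_nat_nat) (auto intro: less_le_trans[OF _ exp_ge_zero])
  show "exp (real (Suc m)) \<le> real (jump_pos m)" "real (jump_pos m) < exp (real (Suc m)) + 1"
    unfolding * by linarith+
qed

lemma strict_mono_jump_pos: "strict_mono jump_pos"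
proof (rule strict_mono_Suc_iff[THEN iffD2], rule allI)
  fix m
  have "real (jump_pos m) < real (jump_pos (Suc m))"
    using jump_pos_bounds(2)[of m] exp_Suc_gap[of "Suc m"] jump_pos_bounds(1)[of "Suc m"] by linarith
  then show "jump_pos m < jump_pos (Suc m)" by simp
qed

lemma jump_pos_gt_1: "jump_pos m > 1"
proof -
  have "1 < exp (real (Suc m))" by simp
  then have "1 < real (jump_pos m)" using jump_pos_bounds(1)[of m] by linarith
  then show ?thesis by simp
qed

lemma harm_jump_jump_pos: "harm_jump (jump_pos m) = 1 / real (Suc m)"
proof -
  define n where "n = jump_pos m"
  note b = jump_pos_bounds[of m, folded n_def]
  have n: "n > 1" unfolding n_def by (rule jump_pos_gt_1)
  have "real (Suc m) \<le> ln (real n)" using b n by (simp add: ln_ge_iff)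
  moreover have "ln (real n) < real (Suc (Suc m))"
  proof -
    have "real n < exp (real (Suc (Suc m)))" using b(2) exp_Suc_gap[of "Suc m"] by linarith
    then show ?thesis using n by (simp add: ln_less_iff)
  qed
  ultimately have f1: "nat \<lfloor>ln (real n)\<rfloor> = Suc m" by linarith
  have n1: "real (n - 1) = real n - 1" using n by simp
  have "exp (real m) \<le> real (n - 1)" using b(1) exp_Suc_gap[of m] n1 by linarith
  then have "real m \<le> ln (real (n - 1))" using n by (simp add: ln_ge_iff)
  moreover have "ln (real (n - 1)) < real (Suc m)"
  proof -
    have "real (n - 1) < exp (real (Suc m))" using b(2) n1 by linarith
    then show ?thesis using n by (simp add: ln_less_iff)
  qed
  ultimately have f2: "nat \<lfloor>ln (real (n - 1))\<rfloor> = m" by linarith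
  show ?thesis unfolding harm_jump_def n_def[symmetric] f1 f2 by (simp add: harm_Suc field_simps)
qed

text \<open>If the floor of the logarithm changes at n, then some exp j with j at least 1 lies above
  n - 1 and not above n, which makes n its ceiling.\<close>

lemma harm_jump_eq_0: "harm_jump n = 0" if "n \<notin> range jump_pos"
proof (rule ccontr)
  assume neq: "harm_jump n \<noteq> 0"
  then have fl: "\<lfloor>ln (real n)\<rfloor> \<noteq> \<lfloor>ln (real (n - 1))\<rfloor>" by (auto simp: harm_jump_def)
  have n: "n \<ge> 2"
  proof (rule ccontr)
    assume "\<not> n \<ge> 2"
    then have "n = 0 \<or> n = 1" by auto
    then show False using fl by auto
  qed
  define j where "j = \<lfloor>ln (real n)\<rfloor>"
  have "ln (real (n - 1)) \<le> ln (real n)" using n by simp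
  then have "\<lfloor>ln (real (n - 1))\<rfloor> \<le> j" unfolding j_def by (rule floor_mono)
  with fl have "\<lfloor>ln (real (n - 1))\<rfloor> < j" unfolding j_def by linarith
  then have lt: "ln (real (n - 1)) < of_int j" by linarith
  have "0 \<le> ln (real (n - 1))" using n by simp
  with lt have "j \<ge> 1" by linarith
  define m where "m = nat (j - 1)"
  have m: "of_int j = real (Suc m)" using \<open>j \<ge> 1\<close> by (simp add: m_def)
  have "exp (real (Suc m)) \<le> real n"
    unfolding m[symmetric] using n by (simp add: ln_ge_iff[symmetric] j_def)
  moreover have "real (n - 1) < exp (real (Suc m))"
    unfolding m[symmetric] using n lt by (simp add: ln_less_iff)
  ultimately have "\<lceil>exp (real (Suc m))\<rceil> = int n"
    using n by (intro ceiling_unique) auto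
  then have "n = jump_pos m" unfolding jump_pos_def by simp
  with that show False by blast
qed

section \<open>The Dirichlet series of the comparison coefficients\<close>

lemma harm_jump_sums_iff:
  "(\<lambda>m. real (jump_pos m) powr (- s) / real (Suc m)) sums c \<longleftrightarrow> (\<lambda>n. harm_jump n * real n powr (- s)) sums c"
  using sums_mono_reindex[OF strict_mono_jump_pos, of "\<lambda>n. harm_jump n * real n powr (- s)" c]
  by (simp add: harm_jump_eq_0 harm_jump_jump_pos)

text \<open>Rounding exp x up changes it by less than 1, hence its logarithm by at most exp (- x).
  Since 1 - exp (- t) is at most t, replacing the ceiling by exp x costs s times a summable
  term.\<close>

lemma jump_pos_powr_bounds:
  assumes "s > 0"
  shows "real (jump_pos m) powr (- s) \<le> exp (- s * real (Suc m))"
    and "exp (- s * real (Suc m)) - real (jump_pos m) powr (- s) \<le> s * exp (- real (Suc m))"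
proof -
  define g x where "g = real (jump_pos m)" and "x = real (Suc m)"
  note b = jump_pos_bounds[of m, folded g_def x_def]
  have g: "g > 0" using jump_pos_gt_1[of m] by (simp add: g_def)
  have ge: "x \<le> ln g" using b g by (simp add: ln_ge_iff)
  have "ln g - x = ln (g * exp (- x))" using g by (simp add: ln_mult)
  also have "\<dots> \<le> g * exp (- x) - 1" using g by (intro ln_le_minus_one) auto
  also have "\<dots> \<le> (exp x + 1) * exp (- x) - 1" using b by (intro diff_right_mono mult_right_mono) auto
  also have "\<dots> = exp (- x)" by (simp add: algebra_simps exp_add[symmetric])
  finally have le: "ln g - x \<le> exp (- x)" .
  have pw: "g powr (- s) = exp (- s * x) * exp (- (s * (ln g - x)))"
    using g by (simp add: powr_def exp_add[symmetric] algebra_simps)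
  show "g powr (- s) \<le> exp (- s * x)"
    unfolding pw using ge assms by (simp add: mult_le_cancel_left1)
  have "exp (- s * x) - g powr (- s) = exp (- s * x) * (1 - exp (- (s * (ln g - x))))"
    unfolding pw by (simp add: algebra_simps)
  also have "\<dots> \<le> 1 * (s * (ln g - x))"
    using ge assms exp_ge_add_one_self[of "- (s * (ln g - x))"]
    by (intro mult_mono) (auto simp: x_def)
  also have "\<dots> \<le> s * exp (- x)" using le assms by simp
  finally show "exp (- s * x) - g powr (- s) \<le> s * exp (- x)" .
qed

lemma exp_neg_Suc_sums: "s > 0 \<Longrightarrow> (\<lambda>m. exp (- s * real (Suc m)) / real (Suc m)) sums (- ln (1 - exp (- s)))"
proof -
  assume s: "s > 0"
  have "(\<lambda>n. - ((- (- exp (- s))) ^ n) / real n) sums ln (1 + (- exp (- s)))"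
    using s by (intro ln_series') simp
  then have "(\<lambda>n. exp (- s) ^ n / real n) sums (- ln (1 - exp (- s)))"
    by (drule_tac sums_minus) simp
  then have "(\<lambda>m. exp (- s) ^ Suc m / real (Suc m)) sums (- ln (1 - exp (- s)))"
    by (subst sums_Suc_iff) simp
  moreover have "exp (- s) ^ Suc m = exp (- s * real (Suc m))" for m
    by (metis exp_of_nat_mult mult.commute)
  ultimately show ?thesis by simp
qed

lemma summable_harm_jump: "summable (\<lambda>n. harm_jump n * real n powr (- s))" if "s > 0"
proof -
  have "summable (\<lambda>m. real (jump_pos m) powr (- s) / real (Suc m))"
    using jump_pos_powr_bounds(1)[OF that]
    by (intro summable_comparison_test'[OF sums_summable[OF exp_neg_Suc_sums[OF that]], of 0])
       (auto intro!: divide_right_mono)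
  then show ?thesis using harm_jump_sums_iff by (auto simp: summable_def)
qed

text \<open>With exp x in place of its ceiling, the series is the logarithmic series with value - ln
  (1 - exp (- s)). The replacement costs at most \<open>s * C\<close>, and 1 - exp (- s) is
  asymptotic to s.\<close>

lemma suminf_harm_jump_tendsto:
  "((\<lambda>s. (\<Sum>n. harm_jump n * real n powr (- s)) + ln s) \<longlongrightarrow> 0) (at_right 0)"
proof -
  define C where "C = (\<Sum>m. exp (- real (Suc m)))"
  have geo: "summable (\<lambda>m. exp (- real (Suc m)))"
  proof -
    have "summable (\<lambda>m. exp (-1 :: real) ^ Suc m)" by (subst summable_Suc_iff) (simp add: summable_geometric)
    moreover have "exp (-1 :: real) ^ Suc m = exp (- real (Suc m))" for m
      by (metis exp_of_nat_mult mult.commute mult_minus1)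
    ultimately show ?thesis by (simp only:)
  qed
  have bound: "\<bar>(\<Sum>n. harm_jump n * real n powr (- s)) - (- ln (1 - exp (- s)))\<bar> \<le> s * C" if "s > 0" for s
  proof -
    define d where "d m = exp (- s * real (Suc m)) / real (Suc m) - real (jump_pos m) powr (- s) / real (Suc m)" for m
    have "(\<lambda>m. real (jump_pos m) powr (- s) / real (Suc m)) sums (\<Sum>n. harm_jump n * real n powr (- s))"
      unfolding harm_jump_sums_iff using summable_harm_jump[OF that] by (rule summable_sums)
    from sums_diff[OF exp_neg_Suc_sums[OF that] this]
    have d: "d sums (- ln (1 - exp (- s)) - (\<Sum>n. harm_jump n * real n powr (- s)))"
      unfolding d_def .
    have d0: "0 \<le> d m" for m
      unfolding d_def diff_divide_distrib[symmetric] using jump_pos_powr_bounds(1)[OF that, of m]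
      by (intro divide_nonneg_nonneg) (simp_all del: of_nat_Suc)
    have d1: "d m \<le> s * exp (- real (Suc m))" for m
    proof -
      have "d m \<le> (exp (- s * real (Suc m)) - real (jump_pos m) powr (- s)) / 1"
        unfolding d_def diff_divide_distrib[symmetric] using jump_pos_powr_bounds(1)[OF that, of m]
        by (intro divide_left_mono) (simp_all del: of_nat_Suc)
      also have "\<dots> \<le> s * exp (- real (Suc m))" using jump_pos_powr_bounds(2)[OF that, of m] by simp
      finally show ?thesis .
    qed
    have "0 \<le> suminf d" using d d0 by (intro suminf_nonneg) (auto simp: sums_iff)
    moreover have "suminf d \<le> s * C"
      unfolding C_def suminf_mult[OF geo, symmetric] using d d1 geo
      by (intro suminf_le summable_mult) (auto simp: sums_iff)
    ultimately show ?thesis using d by (simp add: sums_iff)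
  qed
  have "((\<lambda>s. (\<Sum>n. harm_jump n * real n powr (- s)) - (- ln (1 - exp (- s)))) \<longlongrightarrow> 0) (at_right 0)"
  proof (rule Lim_null_comparison)
    show "eventually (\<lambda>s. norm ((\<Sum>n. harm_jump n * real n powr (- s)) - (- ln (1 - exp (- s)))) \<le> s * C) (at_right 0)"
      using bound by (auto simp: eventually_at_right_less intro: eventually_mono[OF eventually_at_right_less])
    show "((\<lambda>s. s * C) \<longlongrightarrow> 0) (at_right 0)" by real_asymp
  qed
  moreover have "((\<lambda>s::real. ln s - ln (1 - exp (- s))) \<longlongrightarrow> 0) (at_right 0)" by real_asymp
  ultimately have "((\<lambda>s. ((\<Sum>n. harm_jump n * real n powr (- s)) - (- ln (1 - exp (- s))))
      + (ln s - ln (1 - exp (- s)))) \<longlongrightarrow> 0 + 0) (at_right 0)"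
    by (rule tendsto_add)
  then show ?thesis by simp
qed

text \<open>Euler's constant enters the argument here: its defining limit is taken along the floor
  of ln N, and the rounding disappears under the outer logarithm.\<close>

lemma harm_floor_ln_tendsto:
  "(\<lambda>N. harm (nat \<lfloor>ln (real N)\<rfloor>) - ln (ln (real N))) \<longlonglongrightarrow> euler_mascheroni"
proof -
  have "filterlim (\<lambda>N. nat \<lfloor>ln (real N)\<rfloor>) at_top sequentially" by real_asymp
  from filterlim_compose[OF euler_mascheroni_LIMSEQ this]
  have "(\<lambda>N. harm (nat \<lfloor>ln (real N)\<rfloor>) - ln (real (nat \<lfloor>ln (real N)\<rfloor>)) :: real) \<longlonglongrightarrow> euler_mascheroni" .
  moreover have "(\<lambda>N. ln (real (nat \<lfloor>ln (real N)\<rfloor>)) - ln (ln (real N))) \<longlonglongrightarrow> 0" by real_asymp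
  ultimately have "(\<lambda>N. (harm (nat \<lfloor>ln (real N)\<rfloor>) - ln (real (nat \<lfloor>ln (real N)\<rfloor>)))
      + (ln (real (nat \<lfloor>ln (real N)\<rfloor>)) - ln (ln (real N)))) \<longlonglongrightarrow> euler_mascheroni + 0"
    by (rule tendsto_add)
  then show ?thesis by simp
qed

section \<open>From logarithmic prime sums to products over primes\<close>

lemma sum_telescope_pred: "(\<Sum>k\<le>N. g k - g (k - 1)) = g N - g (0::nat)" for g :: "nat \<Rightarrow> real"
  by (induction N) simp_all

text \<open>The increments of ln ln k stand between the two sequences. They differ from the first by
  O(1/k^2), while their partial sums differ from harmonic numbers at the floor of ln N by a
  convergent quantity.\<close>

lemma summable_log_weight_minus_harm_jump:
  "summable (\<lambda>k. (ln (real k) - ln (real (k - 1))) / ln (real k) - harm_jump k)"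
proof -
  define g where "g k = ln (ln (real k))" for k
  define t where "t k = (ln (real k) - ln (real (k - 1))) / ln (real k) - (g k - g (k - 1))" for k
  define u where "u k = g k - g (k - 1) - harm_jump k" for k
  have "(\<lambda>k::nat. (ln (real k) - ln (real k - 1)) / ln (real k) - (ln (ln (real k)) - ln (ln (real k - 1))))
      \<in> O(\<lambda>k. 1 / real k ^ 2)" by real_asymp
  also have "?this \<longleftrightarrow> t \<in> O(\<lambda>k. 1 / real k ^ 2)"
    by (intro landau_o.big.in_cong eventually_mono[OF eventually_ge_at_top[of 1]]) (auto simp: t_def g_def of_nat_diff)
  finally have "summable t"
    by (rule summable_comparison_test_bigo[rotated]) (simp add: inverse_eq_divide[symmetric] inverse_power_summable)
  moreover have "summable u"
  proof -
    have "(\<Sum>k\<le>N. u k) = - (harm (nat \<lfloor>ln (real N)\<rfloor>) - g N)" for N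
      by (simp only: u_def sum_subtractf[of "\<lambda>k. g k - g (k - 1)" harm_jump] sum_telescope_pred sum_harm_jump)
         (simp add: g_def)
    moreover have "(\<lambda>N. - (harm (nat \<lfloor>ln (real N)\<rfloor>) - g N)) \<longlonglongrightarrow> - euler_mascheroni"
      unfolding g_def by (intro tendsto_minus harm_floor_ln_tendsto)
    ultimately have "u sums (- euler_mascheroni)" by (simp add: sums_def_le)
    then show ?thesis by (rule sums_summable)
  qed
  ultimately have "summable (\<lambda>k. t k + u k)" by (rule summable_add)
  then show ?thesis by (simp add: t_def u_def)
qed

text \<open>The coefficients \<open>c\<close> have bounded partial sums by hypothesis, so
  Dirichlet's test permits division by ln k. This leaves f(p) / p minus \<kappa> times the
  normalized increments of the logarithm, which are then exchanged for
  \<open>harm_jump\<close>.\<close>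

lemma summable_prime_coeff_minus_harm_jump:
  fixes f :: "nat \<Rightarrow> real"
  assumes partial: "\<And>N. \<bar>(\<Sum>n\<le>N. if prime n then f n * ln (real n) / real n else 0) - \<kappa> * ln (real N)\<bar> \<le> B"
  shows "summable (\<lambda>n. (if prime n then f n / real n else 0) - \<kappa> * harm_jump n)"
proof -
  define c where "c k = (if prime k then f k * ln (real k) / real k else 0)
      - \<kappa> * (ln (real k) - ln (real (k - 1)))" for k
  define e where "e k = (ln (real k) - ln (real (k - 1))) / ln (real k) - harm_jump k" for k
  have c_sum: "(\<Sum>k\<le>N. c k) = (\<Sum>n\<le>N. if prime n then f n * ln (real n) / real n else 0) - \<kappa> * ln (real N)" for N
    unfolding c_def sum_subtractf sum_distrib_left[symmetric] 
    by (subst sum_telescope_pred[of "\<lambda>k. ln (real k)", unfolded sum_subtractf]) simp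
  have "\<bar>\<Sum>k<n. c k\<bar> \<le> B" for n
  proof (cases n)
    case 0
    then show ?thesis using partial[of 0] by simp
  next
    case (Suc N)
    then show ?thesis using partial[of N] c_sum[of N] by (simp add: lessThan_Suc_atMost)
  qed
  then have "summable (\<lambda>k. c k * (1 / ln (real k)))"
  \<comment> \<open>At 0 and 1 the quotient 1 / ln k is 0 by convention, so the weights decrease
    only from 2 on.\<close>
  proof (rule dirichlet_test(1)[where K = 2])
    show "(\<lambda>k. 1 / ln (real k)) \<longlonglongrightarrow> 0" by real_asymp
  qed (auto intro!: divide_left_mono mult_pos_pos)
  moreover have "summable (\<lambda>k. \<kappa> * e k)"
    unfolding e_def by (intro summable_mult summable_log_weight_minus_harm_jump)
  ultimately have "summable (\<lambda>k. c k * (1 / ln (real k)) + \<kappa> * e k)" by (rule summable_add)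
  moreover have "c k * (1 / ln (real k)) + \<kappa> * e k = (if prime k then f k / real k else 0) - \<kappa> * harm_jump k" for k
  proof (cases "k \<ge> 2")
    case True
    then have "ln (real k) > 0" by simp
    then show ?thesis by (simp add: c_def e_def field_simps)
  next
    case False
    then have "k = 0 \<or> k = 1" by auto
    then show ?thesis by (auto simp: c_def e_def)
  qed
  ultimately show ?thesis by simp
qed

section \<open>The limit at s = 0 and the general product asymptotics\<close>

lemma tendsto_suminf_powr_weight:
  fixes a :: "nat \<Rightarrow> real"
  assumes "summable a" and a0: "a 0 = 0"
  shows "((\<lambda>s. \<Sum>n. a n * real n powr (- s)) \<longlongrightarrow> suminf a) (at_right 0)"
proof -
  \<comment> \<open>The value of 0 powr (- s) is 0, which would break monotonicity at the first
    index. The maximum with 1 repairs it, and \<open>a 0 = 0\<close> makes the change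
    harmless.\<close>
  have "((\<lambda>s. \<Sum>n. a n * real (max 1 n) powr (- s)) \<longlongrightarrow> suminf a) (at_right 0)"
  proof (rule abel_limit[OF assms(1)])
    show "eventually (\<lambda>s. \<forall>k. 0 \<le> real (max 1 k) powr - s \<and> real (max 1 (Suc k)) powr - s \<le> real (max 1 k) powr - s
        \<and> real (max 1 k) powr - s \<le> 1) (at_right 0)"
      using eventually_at_right_less[of "0::real"]
    proof eventually_elim
      case (elim s)
      have "real (max 1 k) powr - s \<le> 1 powr - s" for k
        using elim by (intro powr_mono2') auto
      with elim show ?case by (auto intro!: powr_mono2' simp del: of_nat_max)
    qed
    show "((\<lambda>s. real (max 1 k) powr - s) \<longlongrightarrow> 1) (at_right 0)" for k
    proof -
      have "((\<lambda>s. real (max 1 k) powr - s) \<longlongrightarrow> real (max 1 k) powr - 0) (at_right 0)"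
        by (intro tendsto_intros) auto
      then show ?thesis by simp
    qed
  qed
  moreover have "a n * real (max 1 n) powr - s = a n * real n powr - s" for n s
    using a0 by (cases n) auto
  ultimately show ?thesis by (simp only:)
qed

text \<open>The logarithm of the Dirichlet series at 1 + s splits into a prime power part
  \<open>r s\<close>, a weighted convergent series \<open>a\<close>, and \<kappa> times the
  comparison series. The logarithm of the finite product splits in the same way at s = 0, with a
  harmonic number for the comparison part. Letting s tend to 0 in the first splitting evaluates the
  constant in the second.\<close>

theorem mertens_product_asymptotics:
  fixes f :: "nat \<Rightarrow> real"
  assumes f_mult: "\<And>m n. f (m * n) = f m * f n" and f0: "f 0 = 0" and f1: "f 1 = 1"
    and f_le: "\<And>n. \<bar>f n\<bar> \<le> 1"
    and partial: "\<And>N. \<bar>(\<Sum>n\<le>N. if prime n then f n * ln (real n) / real n else 0) - \<kappa> * ln (real N)\<bar> \<le> B"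
    and lim: "((\<lambda>s. (\<Sum>n. f n * real n powr (-1 - s)) * s powr \<kappa>) \<longlongrightarrow> l) (at_right 0)" and "l > 0"
  shows "(\<lambda>N. (\<Prod>p\<in>{p. prime p \<and> p \<le> N}. 1 - f p / real p) * ln (real N) powr \<kappa>)
      \<longlonglongrightarrow> 1 / (l * exp (\<kappa> * euler_mascheroni))"
proof -
  define g where "g s n = f n * real n powr (-1 - s)" for s n
  define q where "q n = (if prime n then f n / real n else 0)" for n
  define a where "a n = q n - \<kappa> * harm_jump n" for n
  \<comment> \<open>The quadratic and higher terms of the logarithms. They are bounded by 2 / n^2
    uniformly for s \<ge> 0, so their sum is continuous at 0 from the right by Tannery's
    theorem.\<close>
  define r where "r s n = (if prime n then - ln (1 - g s n) - g s n else 0)" for s n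
  have powr_eq: "real n powr (-1 - s) = real n powr (- s) / real n" for n s
    by (cases "n = 0") (auto simp: powr_diff powr_minus field_simps)
  have g_le: "\<bar>g s n\<bar> \<le> 1 / real n" if "s \<ge> 0" for s n
  proof (cases "n = 0")
    case False
    then have "real n powr (- s) \<le> real n powr 0" using that by (intro powr_mono) auto
    then have "\<bar>f n\<bar> * (real n powr (- s) / real n) \<le> 1 * (1 / real n)"
      using False f_le by (intro mult_mono divide_right_mono) auto
    then show ?thesis unfolding g_def powr_eq by (simp add: abs_mult)
  qed (simp add: g_def f0)
  have g_half: "\<bar>g s p\<bar> \<le> 1 / 2" if "s \<ge> 0" "prime p" for s p
  proof -
    have "1 / real p \<le> 1 / 2" using prime_ge_2_nat[OF that(2)] by (intro divide_left_mono) auto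
    then show ?thesis using g_le[OF that(1), of p] by linarith
  qed
  have r_le: "\<bar>r s n\<bar> \<le> 2 / real n ^ 2" if "s \<ge> 0" for s n
  proof (cases "prime n")
    case True
    have "\<bar>ln (1 + (- g s n)) - (- g s n)\<bar> \<le> 2 * (- g s n)\<^sup>2"
      using g_half[OF that True] by (intro abs_ln_one_plus_x_minus_x_bound) simp
    also have "(- g s n)\<^sup>2 \<le> (1 / real n)\<^sup>2"
      using g_le[OF that, of n] by (simp add: abs_le_square_iff[symmetric])
    finally have "\<bar>ln (1 - g s n) + g s n\<bar> \<le> 2 / real n ^ 2" by (simp add: power_divide)
    moreover have "\<bar>r s n\<bar> = \<bar>ln (1 - g s n) + g s n\<bar>" using True by (simp add: r_def)
    ultimately show ?thesis by simp
  qed (simp add: r_def)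
  have sq: "summable (\<lambda>n. 2 / real n ^ 2)"
    using summable_mult[OF inverse_power_summable[of 2, where 'a = real], of 2] by (simp add: field_simps)
  have r_lim: "((\<lambda>s. suminf (r s)) \<longlongrightarrow> suminf (r 0)) (at_right 0)"
  proof -
    have "((\<lambda>s. r s n) \<longlongrightarrow> r 0 n) (at_right 0)" for n
    proof (cases "prime n")
      case True
      have "((\<lambda>s. g s n) \<longlongrightarrow> f n * real n powr (-1 - 0)) (at_right 0)"
        unfolding g_def using True by (intro tendsto_intros) (auto dest: prime_gt_0_nat)
      then have "((\<lambda>s. g s n) \<longlongrightarrow> g 0 n) (at_right 0)" by (simp add: g_def)
      then show ?thesis using True g_half[OF _ True, of 0] unfolding r_def by (auto intro!: tendsto_intros)
    qed (simp add: r_def)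
    moreover have "eventually (\<lambda>(k, s). norm (r s k) \<le> 2 / real k ^ 2) (at_top \<times>\<^sub>F at_right 0)"
      using eventually_prodI[OF eventually_True eventually_at_right_less[of "0::real"], of at_top]
      by eventually_elim (use r_le in auto)
    ultimately show ?thesis
      using tannerys_theorem[of "\<lambda>n s. r s n" "r 0" "at_right 0" "\<lambda>n. 2 / real n ^ 2"] sq by simp
  qed
  have r_summable: "summable (r s)" if "s \<ge> 0" for s
    using r_le[OF that] by (intro summable_comparison_test'[OF sq, of 0]) auto
  have a_summable: "summable a"
    unfolding a_def q_def by (rule summable_prime_coeff_minus_harm_jump) (rule partial)
  have a0: "a 0 = 0" by (simp add: a_def q_def harm_jump_def)
  have lnZ: "0 < suminf (g s)" "ln (suminf (g s)) = suminf (r s)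
      + ((\<Sum>n. a n * real n powr (- s)) + \<kappa> * (\<Sum>n. harm_jump n * real n powr (- s)))" if s: "s > 0" for s
  proof -
    have abs_g: "summable (\<lambda>n. \<bar>g s n\<bar>)"
    proof (rule summable_comparison_test'[where N = 0])
      show "summable (\<lambda>n. real n powr (-1 - s))" using s by (subst summable_real_powr_iff) simp
      show "norm \<bar>g s n\<bar> \<le> real n powr (-1 - s)" for n
        using f_le[of n] by (simp add: g_def abs_mult mult_left_le_one_le)
    qed
    have g_mult: "g s (m * n) = g s m * g s n" for m n by (simp add: g_def f_mult powr_mult)
    have g_less: "g s p < 1" if "prime p" for p using g_half[of s p] that s by simp
    note * = ln_euler_product_sums[of "g s", OF g_mult _ _ abs_g g_less]
    show "0 < suminf (g s)" by (rule *) (simp_all add: g_def f0 f1[simplified])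
    have "(\<lambda>n. if prime n then - ln (1 - g s n) else 0) sums ln (suminf (g s))"
      by (rule *) (simp_all add: g_def f0 f1[simplified])
    from sums_diff[OF this summable_sums[OF r_summable[of s]]]
    have "(\<lambda>n. (if prime n then - ln (1 - g s n) else 0) - r s n) sums (ln (suminf (g s)) - suminf (r s))"
      using s by simp
    moreover have "(if prime n then - ln (1 - g s n) else 0) - r s n = q n * real n powr (- s)" for n
      by (simp add: r_def g_def q_def powr_eq)
    ultimately have q_sums: "(\<lambda>n. q n * real n powr (- s)) sums (ln (suminf (g s)) - suminf (r s))" by simp
    have hj: "(\<lambda>n. \<kappa> * (harm_jump n * real n powr (- s))) sums (\<kappa> * (\<Sum>n. harm_jump n * real n powr (- s)))"
      by (intro sums_mult summable_sums summable_harm_jump s)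
    from sums_diff[OF q_sums hj]
    have "(\<lambda>n. a n * real n powr (- s)) sums
        (ln (suminf (g s)) - suminf (r s) - \<kappa> * (\<Sum>n. harm_jump n * real n powr (- s)))"
      by (simp add: a_def algebra_simps)
    then show "ln (suminf (g s)) = suminf (r s)
      + ((\<Sum>n. a n * real n powr (- s)) + \<kappa> * (\<Sum>n. harm_jump n * real n powr (- s)))"
      by (simp add: sums_iff)
  qed
  have "((\<lambda>s. suminf (r s) + ((\<Sum>n. a n * real n powr (- s))
      + \<kappa> * ((\<Sum>n. harm_jump n * real n powr (- s)) + ln s))) \<longlongrightarrow> suminf (r 0) + (suminf a + \<kappa> * 0)) (at_right 0)"
    by (intro tendsto_intros r_lim tendsto_suminf_powr_weight a_summable a0 suminf_harm_jump_tendsto)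
  moreover have "((\<lambda>s. suminf (r s) + ((\<Sum>n. a n * real n powr (- s))
      + \<kappa> * ((\<Sum>n. harm_jump n * real n powr (- s)) + ln s))) \<longlongrightarrow> ln l) (at_right 0)"
  proof (rule Lim_transform_eventually)
    show "((\<lambda>s. ln (suminf (g s) * s powr \<kappa>)) \<longlongrightarrow> ln l) (at_right 0)"
      unfolding g_def using \<open>l > 0\<close> by (intro tendsto_ln lim) auto
    show "eventually (\<lambda>s. ln (suminf (g s) * s powr \<kappa>) = suminf (r s) + ((\<Sum>n. a n * real n powr (- s))
      + \<kappa> * ((\<Sum>n. harm_jump n * real n powr (- s)) + ln s))) (at_right 0)"
      using eventually_at_right_less[of "0::real"]
    proof eventually_elim
      case (elim s)
      then have "ln (suminf (g s) * s powr \<kappa>) = ln (suminf (g s)) + \<kappa> * ln s"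
        using lnZ(1)[OF elim] by (simp add: ln_mult ln_powr)
      then show ?case using lnZ(2)[OF elim] by (simp add: algebra_simps)
    qed
  qed
  \<comment> \<open>One function of \<open>s\<close> has been given two limits, one term by term and
    one from the hypothesis on the Dirichlet series. Equating them identifies the constant.\<close>
  ultimately have "suminf (r 0) + (suminf a + \<kappa> * 0) = ln l"
    by (rule tendsto_unique[OF trivial_limit_at_right_real])
  then have ln_l: "ln l = suminf (r 0) + suminf a" by simp
  define P where "P N = (\<Prod>p\<in>{p. prime p \<and> p \<le> N}. 1 - f p / real p)" for N
  have g_zero: "g 0 p = f p / real p" for p
    unfolding g_def powr_eq by (cases "p = 0") auto
  have less1: "f p / real p < 1" if "prime p" for p
    using g_half[OF order_refl that, unfolded g_zero] by linarith
  have P_pos: "P N > 0" for N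
    unfolding P_def by (intro prod_pos) (auto dest: less1)
  have lnP: "ln (P N) = - ((\<Sum>n\<le>N. r 0 n) + ((\<Sum>n\<le>N. a n) + \<kappa> * harm (nat \<lfloor>ln (real N)\<rfloor>)))" for N
  proof -
    have "ln (P N) = (\<Sum>p\<in>{p. prime p \<and> p \<le> N}. ln (1 - f p / real p))"
      unfolding P_def by (intro ln_prod) (auto dest: less1)
    also have "{p. prime p \<and> p \<le> N} = {n\<in>{..N}. prime n}" by auto
    also have "(\<Sum>n\<in>{n\<in>{..N}. prime n}. ln (1 - f n / real n)) = (\<Sum>n\<le>N. if prime n then ln (1 - f n / real n) else 0)"
      by (intro sum.inter_filter) simp
    also have "\<dots> = (\<Sum>n\<le>N. - (r 0 n + (a n + \<kappa> * harm_jump n)))"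
      by (intro sum.cong) (auto simp: r_def g_zero a_def q_def)
    finally show ?thesis
      by (simp only: sum_negf sum.distrib sum_distrib_left[symmetric] sum_harm_jump)
  qed
  \<comment> \<open>Subtracting ln ln N inside the exponential corresponds to the normalizing power
    of ln N outside and leaves a convergent exponent.\<close>
  have "(\<lambda>N. exp (- ((\<Sum>n\<le>N. r 0 n) + ((\<Sum>n\<le>N. a n) + \<kappa> * (harm (nat \<lfloor>ln (real N)\<rfloor>) - ln (ln (real N)))))))
      \<longlonglongrightarrow> exp (- (suminf (r 0) + (suminf a + \<kappa> * euler_mascheroni)))"
    by (intro tendsto_intros summable_LIMSEQ' r_summable a_summable harm_floor_ln_tendsto) simp
  also have "exp (- (suminf (r 0) + (suminf a + \<kappa> * euler_mascheroni))) = 1 / (l * exp (\<kappa> * euler_mascheroni))"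
  proof -
    have "exp (- (suminf (r 0) + (suminf a + \<kappa> * euler_mascheroni))) = exp (- (ln l + \<kappa> * euler_mascheroni))"
      unfolding ln_l by (simp add: add.assoc)
    also have "\<dots> = inverse (l * exp (\<kappa> * euler_mascheroni))"
      unfolding exp_minus exp_add using \<open>l > 0\<close> by simp
    finally show ?thesis by (simp add: divide_inverse)
  qed
  finally have "(\<lambda>N. exp (- ((\<Sum>n\<le>N. r 0 n) + ((\<Sum>n\<le>N. a n) + \<kappa> * (harm (nat \<lfloor>ln (real N)\<rfloor>) - ln (ln (real N)))))))
      \<longlonglongrightarrow> 1 / (l * exp (\<kappa> * euler_mascheroni))" .
  moreover have "eventually (\<lambda>N. exp (- ((\<Sum>n\<le>N. r 0 n) + ((\<Sum>n\<le>N. a n) + \<kappa> * (harm (nat \<lfloor>ln (real N)\<rfloor>) - ln (ln (real N)))))) =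
      P N * ln (real N) powr \<kappa>) sequentially"
    using eventually_ge_at_top[of 2]
  proof eventually_elim
    case (elim N)
    then have L: "ln (real N) > 0" by simp
    have "exp (- ((\<Sum>n\<le>N. r 0 n) + ((\<Sum>n\<le>N. a n) + \<kappa> * (harm (nat \<lfloor>ln (real N)\<rfloor>) - ln (ln (real N))))))
        = exp (ln (P N) + \<kappa> * ln (ln (real N)))"
      unfolding lnP by (simp add: algebra_simps)
    also have "\<dots> = P N * ln (real N) powr \<kappa>"
      using L P_pos[of N] by (simp add: exp_add powr_def)
    finally show ?case .
  qed
  ultimately show ?thesis unfolding P_def by (rule Lim_transform_eventually)
qed

section \<open>Chebyshev bounds\<close>

text \<open>Both sides run over the pairs (d, m) with d m \<le> N, grouped by the product on the
  left and by d on the right.\<close>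

lemma sum_divisors_swap:
  fixes h :: "nat \<Rightarrow> nat \<Rightarrow> real"
  shows "(\<Sum>n\<in>{1..N}. \<Sum>d | d dvd n. h d (n div d)) = (\<Sum>d\<in>{1..N}. \<Sum>m\<in>{1..N div d}. h d m)"
proof -
  have le: "d \<le> N" if "d * m \<le> N" "0 < m" for d m :: nat
    by (rule order_trans[OF _ that(1)]) (use that in simp)
  have "(\<Sum>n\<in>{1..N}. \<Sum>d | d dvd n. h d (n div d))
      = (\<Sum>(n, d)\<in>(SIGMA n:{1..N}. {d. d dvd n}). h d (n div d))"
    by (rule sum.Sigma) (auto intro!: finite_divisors_nat)
  also have "\<dots> = (\<Sum>(d, m)\<in>(SIGMA d:{1..N}. {1..N div d}). h d m)"
    by (rule sum.reindex_bij_witness[where i = "\<lambda>(d, m). (d * m, d)" and j = "\<lambda>(n, d). (d, n div d)"])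
       (auto simp: div_le_mono less_eq_div_iff_mult_less_eq mult.commute Suc_le_eq
          intro: dvd_pos_nat le elim!: dvdE)
  also have "\<dots> = (\<Sum>d\<in>{1..N}. \<Sum>m\<in>{1..N div d}. h d m)"
    by (rule sum.Sigma[symmetric]) auto
  finally show ?thesis .
qed

text \<open>Chebyshev's identity, from ln n being the sum of the von Mangoldt function over the
  divisors of n. The range extends to any \<open>M\<close> above \<open>N\<close>, where the
  quotients vanish, so that factorials of n and 2n can be compared over one range.\<close>

lemma ln_fact_eq_sum_mangoldt:
  assumes "N \<le> M"
  shows "ln (fact N :: real) = (\<Sum>d\<in>{1..M}. mangoldt d * real (N div d))"
proof -
  have "ln (fact N :: real) = (\<Sum>n\<in>{1..N}. ln (real n))"
    unfolding fact_prod of_nat_prod by (subst ln_prod) auto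
  also have "\<dots> = (\<Sum>n\<in>{1..N}. \<Sum>d | d dvd n. mangoldt d)"
    by (intro sum.cong refl) (subst mangoldt_sum, auto)
  also have "\<dots> = (\<Sum>d\<in>{1..N}. \<Sum>m\<in>{1..N div d}. mangoldt d)"
    by (rule sum_divisors_swap)
  also have "\<dots> = (\<Sum>d\<in>{1..N}. mangoldt d * real (N div d))"
    by (simp add: mult.commute)
  also have "\<dots> = (\<Sum>d\<in>{1..M}. mangoldt d * real (N div d))"
    using assms by (intro sum.mono_neutral_left) auto
  finally show ?thesis .
qed

text \<open>The coefficient floor(2n/d) - 2 floor(n/d) is nonnegative and equals 1 for n < d \<le>
  2n. Summed against the von Mangoldt function it gives the logarithm of the central binomial
  coefficient, which is at most 4^n.\<close>

lemma sum_mangoldt_double: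
  "(\<Sum>d\<in>{1..2*n}. mangoldt d) \<le> (\<Sum>d\<in>{1..n}. mangoldt d) + 2 * real n * ln 2"
proof -
  have "(\<Sum>d\<in>{1..2*n}. mangoldt d) - (\<Sum>d\<in>{1..n}. mangoldt d) = (\<Sum>d\<in>{n<..2*n}. mangoldt d :: real)"
  proof -
    have "{1..2*n} = {1..n} \<union> {n<..2*n}" by auto
    then have "(\<Sum>d\<in>{1..2*n}. mangoldt d) = (\<Sum>d\<in>{1..n}. mangoldt d) + (\<Sum>d\<in>{n<..2*n}. mangoldt d :: real)"
      by (simp add: sum.union_disjoint[symmetric] ivl_disj_int)
    then show ?thesis by simp
  qed
  also have "\<dots> \<le> (\<Sum>d\<in>{n<..2*n}. mangoldt d * (real (2 * n div d) - 2 * real (n div d)))"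
  proof (rule sum_mono)
    fix d assume d: "d \<in> {n<..2*n}"
    then have "2 * n div d = 1" by (intro div_nat_eqI) auto
    moreover have "n div d = 0" using d by simp
    ultimately show "mangoldt d \<le> mangoldt d * (real (2 * n div d) - 2 * real (n div d))" by simp
  qed
  also have "\<dots> \<le> (\<Sum>d\<in>{1..2*n}. mangoldt d * (real (2 * n div d) - 2 * real (n div d)))"
  proof (intro sum_mono2 mult_nonneg_nonneg mangoldt_nonneg)
    fix d
    have "2 * (n div d) \<le> 2 * n div d" by (metis div_mult2_eq div_times_less_eq_dividend mult.assoc mult_le_mono2 
          less_eq_div_iff_mult_less_eq gr0I div_by_0 mult_0_right le0)
    then show "0 \<le> real (2 * n div d) - 2 * real (n div d)" by linarith
  qed auto
  also have "\<dots> = ln (fact (2 * n)) - 2 * ln (fact n)"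
    by (simp add: ln_fact_eq_sum_mangoldt[of "2*n" "2*n"] ln_fact_eq_sum_mangoldt[of n "2*n"]
        right_diff_distrib sum_subtractf sum_distrib_left mult.left_commute)
  also have "\<dots> = ln (real (2 * n choose n))"
  proof -
    have "real (2 * n choose n) = fact (2 * n) / (fact n * fact n)"
      by (subst binomial_fact) (simp_all add: mult_2)
    then show ?thesis by (simp add: ln_div ln_mult)
  qed
  also have "\<dots> \<le> ln (2 ^ (2 * n))"
  proof -
    have "2 * n choose n \<le> 2 ^ (2 * n)" by (rule binomial_le_pow2)
    then have "real (2 * n choose n) \<le> 2 ^ (2 * n)" by (metis of_nat_le_iff of_nat_numeral of_nat_power)
    then show ?thesis by simp
  qed
  also have "\<dots> = 2 * real n * ln 2" by (simp add: ln_realpow)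
  finally show ?thesis by simp
qed

text \<open>Repeated halving with ln 2 \<le> 1. The constant 4 leaves room for odd n = 2m + 1, where
  rounding up to 2(m + 1) gives 6(m + 1) \<le> 8m + 4 for m \<ge> 1.\<close>

lemma sum_mangoldt_le: "(\<Sum>d\<in>{1..n}. mangoldt d) \<le> 4 * real n"
proof (induction n rule: less_induct)
  case (less n)
  have ln2: "ln 2 \<le> (1 :: real)" using ln_2_less_1 by simp
  consider "n = 0" | "n = 1" | m where "n = 2 * m" "m \<ge> 1" | m where "n = 2 * m + 1" "m \<ge> 1"
    by (metis One_nat_def Suc_leI add_0 add_cancel_right_left bot_nat_0.not_eq_extremum mult_0_right oddE evenE)
  then show ?case
  proof cases
    case 3
    have "(\<Sum>d\<in>{1..n}. mangoldt d) \<le> (\<Sum>d\<in>{1..m}. mangoldt d) + 2 * real m * ln 2"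
      unfolding 3 by (rule sum_mangoldt_double)
    also have "\<dots> \<le> 4 * real m + 2 * real m * 1"
      using 3 ln2 by (intro add_mono less mult_left_mono) auto
    finally show ?thesis using 3 by simp
  next
    case 4
    have "(\<Sum>d\<in>{1..n}. mangoldt d :: real) \<le> (\<Sum>d\<in>{1..2*(m+1)}. mangoldt d)"
      using 4 by (intro sum_mono2 mangoldt_nonneg) auto
    also have "\<dots> \<le> (\<Sum>d\<in>{1..m+1}. mangoldt d) + 2 * real (m + 1) * ln 2"
      by (rule sum_mangoldt_double)
    also have "\<dots> \<le> 4 * real (m + 1) + 2 * real (m + 1) * 1"
      using 4 ln2 by (intro add_mono less mult_left_mono) auto
    finally show ?thesis using 4 by simp
  qed auto
qed

section \<open>Mertens' first estimate and its restriction to primes\<close>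

lemma ln_fact_ge: "real N * ln (real N) - real N \<le> ln (fact N)"
proof (induction N)
  case (Suc N)
  show ?case
  proof (cases "N = 0")
    case False
    then have "ln (real N + 1) - ln (real N) < 1 / real N" by (intro ln_diff_le_inverse) simp
    with False have "real N * (ln (real N + 1) - ln (real N)) \<le> 1" by (simp add: field_simps)
    then have "real (Suc N) * ln (real (Suc N)) - real (Suc N) \<le> ln (real (Suc N)) + (real N * ln (real N) - real N)"
      by (simp add: algebra_simps)
    also have "\<dots> \<le> ln (real (Suc N)) + ln (fact N)" using Suc by simp
    also have "\<dots> = ln (fact (Suc N))" by (simp add: ln_mult del: of_nat_Suc)
    finally show ?thesis .
  qed simp
qed simp

text \<open>In Chebyshev's identity the integer quotient differs from N/d by at most 1, so the total
  error is at most 4 N by the Chebyshev bound. Dividing by N and using N ln N - N \<le> ln N! \<le>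
  N ln N gives the result.\<close>

lemma sum_mangoldt_over_n:
  "\<bar>(\<Sum>d\<in>{1..N}. mangoldt d / real d) - ln (real N)\<bar> \<le> 4"
proof (cases "N = 0")
  case False
  define S where "S = (\<Sum>d\<in>{1..N}. mangoldt d / real d)"
  have div_bounds: "real N / real d - 1 \<le> real (N div d)" "real (N div d) \<le> real N / real d" for d
    using floor_correct[of "real N / real d"] of_nat_div_le_of_nat[of N d, where 'a = real]
    by (auto simp: floor_divide_of_nat_eq)
  have "ln (fact N) \<le> (\<Sum>d\<in>{1..N}. mangoldt d * (real N / real d))"
    unfolding ln_fact_eq_sum_mangoldt[OF order_refl]
    by (intro sum_mono mult_left_mono div_bounds mangoldt_nonneg)
  also have "\<dots> = real N * S" by (simp add: S_def sum_distrib_left mult.commute)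
  finally have up: "ln (fact N) \<le> real N * S" .
  have "real N * S - (\<Sum>d\<in>{1..N}. mangoldt d) = (\<Sum>d\<in>{1..N}. mangoldt d * (real N / real d - 1))"
    by (simp add: S_def sum_distrib_left right_diff_distrib sum_subtractf mult.commute)
  also have "\<dots> \<le> ln (fact N)"
    unfolding ln_fact_eq_sum_mangoldt[OF order_refl]
    by (intro sum_mono mult_left_mono div_bounds mangoldt_nonneg)
  finally have lo: "real N * S - (\<Sum>d\<in>{1..N}. mangoldt d) \<le> ln (fact N)" .
  have "ln (fact N :: real) \<le> ln (real N ^ N)"
    using False fact_le_power[of N, where 'a = real] by (subst ln_le_cancel_iff) auto
  then have fact_up: "ln (fact N :: real) \<le> real N * ln (real N)" using False by (simp add: ln_realpow)
  have "real N * S \<le> real N * (ln (real N) + 4)"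
    using lo fact_up sum_mangoldt_le[of N] by (simp add: algebra_simps)
  then have "S \<le> ln (real N) + 4" using False by simp
  moreover have "real N * (ln (real N) - 1) \<le> real N * S"
    using up ln_fact_ge[of N] by (simp add: algebra_simps)
  then have "ln (real N) - 1 \<le> S" using False by simp
  ultimately show ?thesis unfolding S_def[symmetric] by linarith
qed simp

text \<open>Only prime powers with exponent at least 2 contribute. For fixed p they form a geometric
  series of ratio at most 1/2, which is bounded by 2 ln p / p^2.\<close>

lemma sum_mangoldt_nonprime_bounded:
  obtains C where "\<And>N. (\<Sum>d\<in>{d\<in>{1..N}. \<not> prime d}. mangoldt d / real d) \<le> C"
proof
  define h where "h n = 2 * (ln (real n) / real n ^ 2)" for n
  have "(\<lambda>n. ln (real n) / real n ^ 2) \<in> O(\<lambda>n. real n powr (-3/2))" by real_asymp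
  then have "summable (\<lambda>n. ln (real n) / real n ^ 2)"
    by (rule summable_comparison_test_bigo[rotated]) (simp add: summable_real_powr_iff)
  then have h: "summable h" unfolding h_def by (rule summable_mult)
  show "(\<Sum>d\<in>{d\<in>{1..N}. \<not> prime d}. mangoldt d / real d) \<le> suminf h" for N
  proof -
    have "(\<Sum>d\<in>{d\<in>{1..N}. \<not> prime d}. mangoldt d / real d :: real)
        = (\<Sum>d\<in>{d\<in>{1..N}. primepow d \<and> \<not> prime d}. mangoldt d / real d)"
      by (rule sum.mono_neutral_right) (auto simp: mangoldt_def)
    also have "\<dots> \<le> (\<Sum>(p, k)\<in>{2..N} \<times> {2..N}. ln (real p) * (1 / real p) ^ k)"
    \<comment> \<open>Base and exponent both stay below N because p \<le> p^k and k < p^k, so a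
      finite square of pairs covers all the prime powers.\<close>
    proof (rule sum_le_included[where i = "\<lambda>(p, k). p ^ k"])
      show "\<forall>d\<in>{d\<in>{1..N}. primepow d \<and> \<not> prime d}. \<exists>y\<in>{2..N} \<times> {2..N}. (case y of (p, k) \<Rightarrow> p ^ k) = d \<and>
            mangoldt d / real d \<le> (case y of (p, k) \<Rightarrow> ln (real p) * (1 / real p) ^ k)"
      proof
        fix d assume d: "d \<in> {d\<in>{1..N}. primepow d \<and> \<not> prime d}"
        then obtain p k where pk: "prime p" "k > 0" "d = p ^ k" by (auto simp: primepow_def)
        with d have "k \<noteq> 1" by auto
        with pk have k: "k \<ge> 2" by auto
        have p: "p \<ge> 2" using pk by (simp add: prime_ge_2_nat)
        have "p ^ 1 \<le> p ^ k" using p k by (intro power_increasing) auto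
        then have pN: "p \<le> N" using pk d by auto
        have "k < p ^ k" using p by (intro power_gt_expt) auto
        then have kN: "k \<le> N" using pk d by auto
        have "mangoldt d / real d = ln (real p) * (1 / real p) ^ k"
          using pk by (simp add: power_divide)
        then show "\<exists>y\<in>{2..N} \<times> {2..N}. (case y of (p, k) \<Rightarrow> p ^ k) = d \<and>
            mangoldt d / real d \<le> (case y of (p, k) \<Rightarrow> ln (real p) * (1 / real p) ^ k)"
          using p k pN kN pk by (intro bexI[of _ "(p, k)"]) auto
      qed
    qed auto
    also have "\<dots> = (\<Sum>p\<in>{2..N}. \<Sum>k\<in>{2..N}. ln (real p) * (1 / real p) ^ k)"
      by (rule sum.Sigma[symmetric]) auto
    also have "\<dots> \<le> (\<Sum>p\<in>{2..N}. h p)"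
    proof (rule sum_mono)
      fix p assume "p \<in> {2..N}"
      then have p: "p \<ge> 2" "N \<ge> 2" by auto
      define x where "x = 1 / real p"
      have x: "0 < x" "x \<le> 1 / 2" using p by (auto simp: x_def field_simps)
      have "(1 / 2) * (\<Sum>k\<in>{2..N}. x ^ k) \<le> (1 - x) * (\<Sum>k\<in>{2..N}. x ^ k)"
        using x by (intro mult_right_mono sum_nonneg) auto
      also have "\<dots> = x ^ 2 - x ^ Suc N" using p by (intro sum_gp_multiplied)
      also have "\<dots> \<le> x ^ 2" using x by simp
      finally have "(\<Sum>k\<in>{2..N}. x ^ k) \<le> 2 * x ^ 2" by simp
      then have "ln (real p) * (\<Sum>k\<in>{2..N}. x ^ k) \<le> ln (real p) * (2 * x ^ 2)"
        using p by (intro mult_left_mono) auto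
      then show "(\<Sum>k\<in>{2..N}. ln (real p) * (1 / real p) ^ k) \<le> h p"
        unfolding h_def x_def by (simp add: sum_distrib_left power_divide mult.commute)
    qed
    also have "\<dots> \<le> suminf h"
    proof (intro sum_le_suminf h)
      show "0 \<le> h n" for n by (cases "n = 0") (auto simp: h_def)
    qed auto
    finally show ?thesis .
  qed
qed

lemma sum_prime_log_bounded:
  fixes f :: "nat \<Rightarrow> real"
  assumes f_le: "\<And>n. \<bar>f n\<bar> \<le> 1"
    and mangoldt: "\<And>N. \<bar>(\<Sum>d\<in>{1..N}. mangoldt d * f d / real d) - \<kappa> * ln (real N)\<bar> \<le> B"
  obtains C where "\<And>N. \<bar>(\<Sum>n\<le>N. if prime n then f n * ln (real n) / real n else 0) - \<kappa> * ln (real N)\<bar> \<le> C"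
proof -
  obtain C where C: "\<And>N. (\<Sum>d\<in>{d\<in>{1..N}. \<not> prime d}. mangoldt d / real d) \<le> C"
    by (rule sum_mangoldt_nonprime_bounded) blast
  have "\<bar>(\<Sum>n\<le>N. if prime n then f n * ln (real n) / real n else 0) - \<kappa> * ln (real N)\<bar> \<le> B + C" for N
  proof -
    have "(\<Sum>n\<le>N. if prime n then f n * ln (real n) / real n else 0)
        = (\<Sum>d\<in>{1..N}. if prime d then f d * ln (real d) / real d else 0)"
      by (rule sum.mono_neutral_right) (auto simp: Suc_le_eq)
    moreover have "(\<Sum>d\<in>{1..N}. mangoldt d * f d / real d) =
        (\<Sum>d\<in>{1..N}. (if prime d then f d * ln (real d) / real d else 0)
          + (if \<not> prime d then mangoldt d * f d / real d else 0))"
      by (intro sum.cong) (auto simp: mult.commute)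
    moreover have "(\<Sum>d\<in>{d\<in>{1..N}. \<not> prime d}. mangoldt d * f d / real d)
        = (\<Sum>d\<in>{1..N}. if \<not> prime d then mangoldt d * f d / real d else 0)"
      by (intro sum.inter_filter) simp
    ultimately have eq: "(\<Sum>d\<in>{1..N}. mangoldt d * f d / real d) =
        (\<Sum>n\<le>N. if prime n then f n * ln (real n) / real n else 0)
        + (\<Sum>d\<in>{d\<in>{1..N}. \<not> prime d}. mangoldt d * f d / real d)"
      by (simp only: sum.distrib)
    have "\<bar>\<Sum>d\<in>{d\<in>{1..N}. \<not> prime d}. mangoldt d * f d / real d\<bar>
        \<le> (\<Sum>d\<in>{d\<in>{1..N}. \<not> prime d}. mangoldt d / real d)"
      using f_le mangoldt_nonneg
      by (intro order_trans[OF sum_abs] sum_mono) (auto simp: abs_mult intro!: divide_right_mono mult_left_le)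
    with C[of N] mangoldt[of N] eq show ?thesis by linarith
  qed
  then show ?thesis by (rule that)
qed

section \<open>Mertens products\<close>

text \<open>The mean value theorem writes the decrement of n^(-s) as s x^(-1-s) with x between
  neighbouring integers, and these decrements telescope to 1. Comparison on both sides gives 1 \<le>
  s \<zeta>(1 + s) \<le> 1 + s.\<close>

lemma zeta_residue:
  "((\<lambda>s. (\<Sum>n. (if n = 0 then 0 else 1) * real n powr (-1 - s)) * s powr 1) \<longlongrightarrow> 1) (at_right 0)"
proof -
  have bounds: "1 \<le> (\<Sum>n. (if n = 0 then 0 else 1) * real n powr (-1 - s)) * s powr 1 \<and>
      (\<Sum>n. (if n = 0 then 0 else 1) * real n powr (-1 - s)) * s powr 1 \<le> 1 + s" if s: "s > 0" for s
  proof -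
    define z where "z n = real (Suc n) powr (-1 - s)" for n
    define b where "b n = real (Suc n) powr (- s)" for n
    have b0: "b \<longlonglongrightarrow> 0" unfolding b_def using s by real_asymp
    have diff: "s * z (Suc n) \<le> b n - b (Suc n)" "b n - b (Suc n) \<le> s * z n" for n
    proof -
      have "\<exists>x>real (Suc n). x < real (Suc (Suc n)) \<and>
          real (Suc (Suc n)) powr (- s) - real (Suc n) powr (- s)
            = (real (Suc (Suc n)) - real (Suc n)) * (- s * x powr (- s - 1))"
        by (intro MVT2) (auto intro!: derivative_eq_intros simp: field_simps powr_diff)
      then obtain x where x: "real (Suc n) < x" "x < real (Suc (Suc n))"
        "real (Suc (Suc n)) powr (- s) - real (Suc n) powr (- s)
            = (real (Suc (Suc n)) - real (Suc n)) * (- s * x powr (- s - 1))"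
        by blast
      have e: "- s - 1 = -1 - s" by simp
      have "b (Suc n) - b n = (real (Suc (Suc n)) - real (Suc n)) * (- s * x powr (-1 - s))"
        unfolding b_def using x(3) by (simp only: e)
      also have "\<dots> = - (s * x powr (-1 - s))" by simp
      finally have b_diff: "b n - b (Suc n) = s * x powr (-1 - s)" by linarith
      have "real (Suc (Suc n)) powr (-1 - s) \<le> x powr (-1 - s)" "x powr (-1 - s) \<le> real (Suc n) powr (-1 - s)"
        using x(1,2) s by (intro powr_mono2'; simp)+
      then show "s * z (Suc n) \<le> b n - b (Suc n)" "b n - b (Suc n) \<le> s * z n"
        unfolding b_diff z_def using s by (auto intro!: mult_left_mono)
    qed
    have tele: "(\<lambda>n. b n - b (Suc n)) sums 1"
      using telescope_sums'[OF b0] by (simp add: b_def)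
    have "summable (\<lambda>n. real n powr (-1 - s))" using s by (subst summable_real_powr_iff) simp
    then have z: "summable z" unfolding z_def by (subst summable_Suc_iff)
    have Z: "(\<Sum>n. (if n = 0 then 0 else 1) * real n powr (-1 - s)) = suminf z"
    proof -
      have "(\<lambda>n. (if Suc n = 0 then 0 else 1) * real (Suc n) powr (-1 - s)) sums suminf z"
        using summable_sums[OF z] unfolding z_def[abs_def] by (simp only: nat.distinct if_False mult_1)
      then have "(\<lambda>n. (if n = 0 then 0 else 1) * real n powr (-1 - s)) sums suminf z"
        by (subst (asm) sums_Suc_iff) simp
      then show ?thesis by (simp add: sums_iff)
    qed
    have "1 \<le> s * suminf z"
      unfolding suminf_mult[OF z, symmetric] using diff(2) tele z
      by (subst sums_unique[OF tele]) (intro suminf_le summable_mult, auto simp: sums_iff)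
    moreover have "s * suminf z \<le> 1 + s"
    proof -
      have zS: "summable (\<lambda>n. z (Suc n))" using z by (subst summable_Suc_iff)
      have "s * (\<Sum>n. z (Suc n)) \<le> 1"
        unfolding suminf_mult[OF zS, symmetric] using diff(1) tele zS
        by (subst sums_unique[OF tele]) (intro suminf_le summable_mult, auto simp: sums_iff)
      moreover have "(\<Sum>n. z (Suc n)) = suminf z - 1"
        using suminf_split_head[OF z] by (simp add: z_def)
      ultimately show ?thesis by (simp add: algebra_simps)
    qed
    ultimately show ?thesis using s unfolding Z by (simp add: mult.commute)
  qed
  show ?thesis
  proof (rule tendsto_sandwich)
    show "((\<lambda>s::real. 1) \<longlongrightarrow> 1) (at_right 0)" by simp
    show "((\<lambda>s::real. 1 + s) \<longlongrightarrow> 1) (at_right 0)" by real_asymp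
  qed (use bounds in \<open>auto intro: eventually_mono[OF eventually_at_right_less]\<close>)
qed

text \<open>The general asymptotics with coefficient 1 at positive integers, \<kappa> = 1 and l = 1.
  The extra value 0 at index 0 meets the multiplicative hypotheses.\<close>

theorem mertens_third:
  "(\<lambda>N. (\<Prod>p\<in>{p. prime p \<and> p \<le> N}. 1 - 1 / real p) * ln (real N)) \<longlonglongrightarrow> exp (- euler_mascheroni)"
proof -
  define f :: "nat \<Rightarrow> real" where "f n = (if n = 0 then 0 else 1)" for n
  have "\<bar>(\<Sum>d\<in>{1..N}. mangoldt d * f d / real d) - 1 * ln (real N)\<bar> \<le> 4" for N
  proof -
    have "(\<Sum>d\<in>{1..N}. mangoldt d * f d / real d :: real) = (\<Sum>d\<in>{1..N}. mangoldt d / real d)"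
      by (intro sum.cong) (auto simp: f_def)
    then show ?thesis using sum_mangoldt_over_n[of N] by simp
  qed
  then obtain C where C: "\<And>N. \<bar>(\<Sum>n\<le>N. if prime n then f n * ln (real n) / real n else 0) - 1 * ln (real N)\<bar> \<le> C"
    by (rule sum_prime_log_bounded[rotated]) (auto simp: f_def)
  have "(\<lambda>N. (\<Prod>p\<in>{p. prime p \<and> p \<le> N}. 1 - f p / real p) * ln (real N) powr 1)
      \<longlonglongrightarrow> 1 / (1 * exp (1 * euler_mascheroni))"
    using zeta_residue by (intro mertens_product_asymptotics[OF _ _ _ _ C]) (auto simp: f_def)
  also have "1 / (1 * exp (1 * euler_mascheroni)) = exp (- euler_mascheroni :: real)"
    by (simp add: exp_minus divide_inverse)
  finally have *: "(\<lambda>N. (\<Prod>p\<in>{p. prime p \<and> p \<le> N}. 1 - f p / real p) * ln (real N) powr 1)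
      \<longlonglongrightarrow> exp (- euler_mascheroni)" .
  show ?thesis
  proof (rule Lim_transform_eventually[OF *])
    show "eventually (\<lambda>N. (\<Prod>p\<in>{p. prime p \<and> p \<le> N}. 1 - f p / real p) * ln (real N) powr 1 =
        (\<Prod>p\<in>{p. prime p \<and> p \<le> N}. 1 - 1 / real p) * ln (real N)) sequentially"
      using eventually_ge_at_top[of 1]
    proof eventually_elim
      case (elim N)
      have "(\<Prod>p\<in>{p. prime p \<and> p \<le> N}. 1 - f p / real p) = (\<Prod>p\<in>{p. prime p \<and> p \<le> N}. 1 - 1 / real p)"
        by (intro prod.cong) (auto simp: f_def)
      then show ?case using elim by simp
    qed
  qed
qed

section \<open>Bounded character sums and the Euler product at 1\<close>

lemma ln_div_decreasing: "ln (real (Suc k)) / real (Suc k) \<le> ln (real k) / real k" if "k \<ge> 3"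
proof -
  \<comment> \<open>The threshold 3 is the first integer above e, so that ln k is at least
    1.\<close>
  have "exp 1 \<le> real k" using e_less_272 that by linarith
  then have "1 \<le> ln (real k)" using that by (subst ln_ge_iff) auto
  moreover have "ln (real k + 1) - ln (real k) < 1 / real k" using that by (intro ln_diff_le_inverse) simp
  then have "real k * (ln (real k + 1) - ln (real k)) \<le> 1" using that by (simp add: field_simps)
  ultimately have "real k * ln (real k + 1) \<le> (real k + 1) * ln (real k)" by (simp add: algebra_simps)
  then show ?thesis using that by (simp add: field_simps)
qed

lemma character_series:
  fixes chi :: "nat \<Rightarrow> real"
  assumes bound: "\<And>n. \<bar>\<Sum>k<n. chi k\<bar> \<le> B"
  shows "summable (\<lambda>n. chi n / real n)"
    and "m \<ge> 1 \<Longrightarrow> \<bar>(\<Sum>n. chi n / real n) - (\<Sum>n<m. chi n / real n)\<bar> \<le> 2 * B / real m"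
proof -
  have lim: "(\<lambda>n. 1 / real n) \<longlonglongrightarrow> 0" by real_asymp
  have decr: "1 / real (Suc k) \<le> 1 / real k" if "k \<ge> 1" for k
    using that by (intro divide_left_mono) auto
  note * = dirichlet_test[of chi B 1 "\<lambda>n. 1 / real n", OF bound _ decr lim]
  show "summable (\<lambda>n. chi n / real n)" using *(1) by simp
  show "\<bar>(\<Sum>n. chi n / real n) - (\<Sum>n<m. chi n / real n)\<bar> \<le> 2 * B / real m" if "m \<ge> 1"
    using *(2)[of m] that by simp
qed

text \<open>Mertens' argument: the sum of chi(n) ln n / n is bounded, and expanding ln n over
  divisors produces the von Mangoldt sum of chi times L, up to a bounded error. Since L is positive,
  the sum of chi(p) ln p / p is bounded, which is the case \<kappa> = 0 of the general
  asymptotics.\<close>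

theorem euler_product_at_1:
  fixes chi :: "nat \<Rightarrow> real"
  assumes mult: "\<And>m n. chi (m * n) = chi m * chi n" and chi_0: "chi 0 = 0" and chi_1: "chi 1 = 1"
    and chi_le: "\<And>n. \<bar>chi n\<bar> \<le> 1" and bound: "\<And>n. \<bar>\<Sum>k<n. chi k\<bar> \<le> B"
    and L_pos: "(\<Sum>n. chi n / real n) > 0"
  shows "(\<lambda>N. \<Prod>p\<in>{p. prime p \<and> p \<le> N}. 1 - chi p / real p) \<longlonglongrightarrow> 1 / (\<Sum>n. chi n / real n)"
proof -
  define L where "L = (\<Sum>n. chi n / real n)"
  note summ = character_series(1)[OF bound]
  have "B \<ge> 0" using bound[of 0] by simp
  have "summable (\<lambda>k. chi k * (ln (real k) / real k))"
  proof (rule dirichlet_test(1)[OF bound, of 3])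
    show "(\<lambda>k. ln (real k) / real k) \<longlonglongrightarrow> 0" by real_asymp
    show "ln (real (Suc k)) / real (Suc k) \<le> ln (real k) / real k" if "k \<ge> 3" for k
      by (rule ln_div_decreasing[OF that])
  qed auto
  then have "Bseq (\<lambda>N. \<Sum>k\<le>N. chi k * (ln (real k) / real k))"
    using summable_LIMSEQ' convergentI convergent_imp_Bseq by blast
  then obtain C where C: "\<And>N. \<bar>\<Sum>k\<le>N. chi k * (ln (real k) / real k)\<bar> \<le> C"
    by (auto simp: Bseq_def)
  have mangoldt_bound: "\<bar>(\<Sum>d\<in>{1..N}. mangoldt d * chi d / real d) - 0 * ln (real N)\<bar> \<le> (C + 8 * B) / L" for N
  proof (cases "N = 0")
    case True
    have "0 \<le> C" using C[of 0] by simp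
    then show ?thesis using True \<open>B \<ge> 0\<close> L_pos by (simp add: L_def)
  next
    case False
    define G where "G M = (\<Sum>m\<in>{1..M}. chi m / real m)" for M
    have G: "\<bar>L - G M\<bar> \<le> 2 * B / real (Suc M)" for M
    proof -
      have "G M = (\<Sum>n<Suc M. chi n / real n)"
        unfolding G_def by (rule sum.mono_neutral_left) (auto simp: Suc_le_eq)
      then show ?thesis using character_series(2)[OF bound, of "Suc M"] by (simp add: L_def)
    qed
    \<comment> \<open>The logarithm is the divisor sum of the von Mangoldt function, and complete
      multiplicativity separates d from the cofactor.\<close>
    have conv: "(\<Sum>k\<le>N. chi k * (ln (real k) / real k)) = (\<Sum>d\<in>{1..N}. mangoldt d * chi d / real d * G (N div d))"
    proof -
      have "(\<Sum>k\<le>N. chi k * (ln (real k) / real k)) = (\<Sum>n\<in>{1..N}. chi n * (ln (real n) / real n))"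
        by (rule sum.mono_neutral_right) (auto simp: Suc_le_eq)
      also have "\<dots> = (\<Sum>n\<in>{1..N}. \<Sum>d | d dvd n. (mangoldt d * chi d / real d) * (chi (n div d) / real (n div d)))"
      proof (rule sum.cong[OF refl])
        fix n assume n: "n \<in> {1..N}"
        have "chi n * (ln (real n) / real n) = (\<Sum>d | d dvd n. chi n / real n * mangoldt d)"
          using n mangoldt_sum[of n, where 'a = real] by (subst sum_distrib_left[symmetric]) simp
        also have "\<dots> = (\<Sum>d | d dvd n. (mangoldt d * chi d / real d) * (chi (n div d) / real (n div d)))"
        proof (rule sum.cong[OF refl])
          fix d assume "d \<in> {d. d dvd n}"
          then obtain e where e: "n = d * e" by blast
          with n have "d > 0" by (cases "d = 0") auto
          then show "chi n / real n * mangoldt d = (mangoldt d * chi d / real d) * (chi (n div d) / real (n div d))"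
            unfolding e by (simp add: mult)
        qed
        finally show "chi n * (ln (real n) / real n) =
          (\<Sum>d | d dvd n. (mangoldt d * chi d / real d) * (chi (n div d) / real (n div d)))" .
      qed
      also have "\<dots> = (\<Sum>d\<in>{1..N}. \<Sum>m\<in>{1..N div d}. (mangoldt d * chi d / real d) * (chi m / real m))"
        by (rule sum_divisors_swap)
      finally show ?thesis by (simp add: G_def sum_distrib_left)
    qed
    have err: "\<bar>\<Sum>d\<in>{1..N}. mangoldt d * chi d / real d * (L - G (N div d))\<bar> \<le> 8 * B"
    proof -
      have "\<bar>\<Sum>d\<in>{1..N}. mangoldt d * chi d / real d * (L - G (N div d))\<bar>
          \<le> (\<Sum>d\<in>{1..N}. \<bar>mangoldt d * chi d / real d * (L - G (N div d))\<bar>)" by (rule sum_abs)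
      also have "\<dots> \<le> (\<Sum>d\<in>{1..N}. mangoldt d * (2 * B / real N))"
      proof (rule sum_mono)
        fix d assume d: "d \<in> {1..N}"
        \<comment> \<open>The successor in the tail bound for L absorbs the rounding, so each term
          costs at most 2B/N times the von Mangoldt value. The Chebyshev bound then gives
          8B.\<close>
        have "real N / real d \<le> real (Suc (N div d))"
          using floor_correct[of "real N / real d"] by (simp add: floor_divide_of_nat_eq)
        then have "2 * B / real (Suc (N div d)) \<le> 2 * B / (real N / real d)"
          using d \<open>B \<ge> 0\<close> by (intro divide_left_mono) auto
        then have LG: "\<bar>L - G (N div d)\<bar> \<le> 2 * B * real d / real N" using G[of "N div d"] by simp
        have "\<bar>mangoldt d * chi d / real d * (L - G (N div d))\<bar>
            = mangoldt d * (\<bar>chi d\<bar> * (\<bar>L - G (N div d)\<bar> / real d))"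
          by (simp add: abs_mult)
        also have "\<dots> \<le> mangoldt d * (1 * ((2 * B * real d / real N) / real d))"
          using chi_le LG \<open>B \<ge> 0\<close>
          by (intro mult_left_mono mult_mono divide_right_mono mangoldt_nonneg) auto
        also have "\<dots> = mangoldt d * (2 * B / real N)" using d by simp
        finally show "\<bar>mangoldt d * chi d / real d * (L - G (N div d))\<bar> \<le> mangoldt d * (2 * B / real N)" .
      qed
      also have "\<dots> = (\<Sum>d\<in>{1..N}. mangoldt d) * (2 * B / real N)"
        by (rule sum_distrib_right[symmetric])
      also have "\<dots> \<le> 4 * real N * (2 * B / real N)"
        using \<open>B \<ge> 0\<close> by (intro mult_right_mono sum_mangoldt_le) auto
      also have "\<dots> = 8 * B" using False by simp
      finally show ?thesis .
    qed
    have "(\<Sum>d\<in>{1..N}. mangoldt d * chi d / real d) * L =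
        (\<Sum>k\<le>N. chi k * (ln (real k) / real k)) + (\<Sum>d\<in>{1..N}. mangoldt d * chi d / real d * (L - G (N div d)))"
      unfolding conv sum.distrib[symmetric] sum_distrib_right
      by (simp add: distrib_left[symmetric] del: times_divide_eq_left times_divide_eq_right)
    then have "\<bar>(\<Sum>d\<in>{1..N}. mangoldt d * chi d / real d) * L\<bar> \<le> C + 8 * B"
      using C[of N] err by linarith
    then show ?thesis using L_pos by (simp add: abs_mult L_def pos_le_divide_eq)
  qed
  obtain C' where C': "\<And>N. \<bar>(\<Sum>n\<le>N. if prime n then chi n * ln (real n) / real n else 0) - 0 * ln (real N)\<bar> \<le> C'"
    by (rule sum_prime_log_bounded[OF chi_le mangoldt_bound]) blast
  have lim: "((\<lambda>s. (\<Sum>n. chi n * real n powr (-1 - s)) * s powr 0) \<longlongrightarrow> L) (at_right 0)"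
  proof (rule Lim_transform_eventually)
    show "((\<lambda>s. \<Sum>n. chi n / real n * real n powr (- s)) \<longlongrightarrow> L) (at_right 0)"
      unfolding L_def by (rule tendsto_suminf_powr_weight[OF summ]) simp
    have weight: "chi n / real n * real n powr (- s) = chi n * real n powr (-1 - s)" for n s
      by (cases "n = 0") (auto simp: powr_diff powr_minus field_simps)
    show "eventually (\<lambda>s. (\<Sum>n. chi n / real n * real n powr (- s)) =
        (\<Sum>n. chi n * real n powr (-1 - s)) * s powr 0) (at_right 0)"
      using eventually_at_right_less[of "0::real"]
    proof eventually_elim
      case (elim s)
      then show ?case unfolding weight by simp
    qed
  qed
  have "(\<lambda>N. (\<Prod>p\<in>{p. prime p \<and> p \<le> N}. 1 - chi p / real p) * ln (real N) powr 0)
      \<longlonglongrightarrow> 1 / (L * exp (0 * euler_mascheroni))"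
    using L_pos by (intro mertens_product_asymptotics[OF mult chi_0 chi_1 chi_le C' lim]) (simp add: L_def)
  then have *: "(\<lambda>N. (\<Prod>p\<in>{p. prime p \<and> p \<le> N}. 1 - chi p / real p) * ln (real N) powr 0) \<longlonglongrightarrow> 1 / L"
    by simp
  show ?thesis
    unfolding L_def[symmetric]
  proof (rule Lim_transform_eventually[OF *])
    show "eventually (\<lambda>N. (\<Prod>p\<in>{p. prime p \<and> p \<le> N}. 1 - chi p / real p) * ln (real N) powr 0 =
        (\<Prod>p\<in>{p. prime p \<and> p \<le> N}. 1 - chi p / real p)) sequentially"
      using eventually_ge_at_top[of 2] by eventually_elim simp
  qed
qed

section \<open>Values of the Legendre symbol\<close>

lemma Legendre_cong: "[a = b] (mod p) \<Longrightarrow> Legendre a p = Legendre b p"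
  unfolding Legendre_def QuadRes_def cong_def by simp

lemma abs_Legendre_le: "\<bar>Legendre a p\<bar> \<le> 1"
  by (simp add: Legendre_def)

text \<open>This turns congruences from Euler's criterion into equalities: two values of absolute
  value at most 1 differ by at most 2, which is less than p.\<close>

lemma cong_abs_le_1_imp_eq:
  fixes a b p :: int
  assumes "[a = b] (mod p)" "\<bar>a\<bar> \<le> 1" "\<bar>b\<bar> \<le> 1" "p > 2"
  shows "a = b"
proof (rule ccontr)
  assume "a \<noteq> b"
  from assms(1) have "p dvd a - b" by (simp add: cong_iff_dvd_diff)
  with \<open>a \<noteq> b\<close> assms(4) have "p \<le> \<bar>a - b\<bar>" using dvd_imp_le_int[of "a - b" p] by simp
  with assms show False by linarith
qed

lemma Legendre_mult:
  assumes "prime p" "2 < p"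
  shows "Legendre (a * b) (int p) = Legendre a (int p) * Legendre b (int p)"
proof (rule cong_abs_le_1_imp_eq)
  have "[Legendre (a * b) (int p) = (a * b) ^ ((p - 1) div 2)] (mod int p)"
    by (rule euler_criterion[OF assms])
  moreover have "[Legendre a (int p) * Legendre b (int p) = a ^ ((p - 1) div 2) * b ^ ((p - 1) div 2)] (mod int p)"
    by (intro cong_mult euler_criterion[OF assms])
  ultimately show "[Legendre (a * b) (int p) = Legendre a (int p) * Legendre b (int p)] (mod int p)"
    by (metis cong_sym cong_trans power_mult_distrib)
  show "\<bar>Legendre a (int p) * Legendre b (int p)\<bar> \<le> 1"
    using abs_Legendre_le[of a "int p"] abs_Legendre_le[of b "int p"] by (simp add: abs_mult mult_le_one)
qed (use assms abs_Legendre_le in auto)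

lemma Legendre_minus_1:
  assumes "prime p" "2 < p"
  shows "Legendre (-1) (int p) = (-1) ^ ((p - 1) div 2)"
  using assms by (intro cong_abs_le_1_imp_eq[OF euler_criterion] abs_Legendre_le) (auto simp: power_abs)



lemma Legendre_4:
  assumes "prime p" "2 < p"
  shows "Legendre 4 (int p) = 1"
proof -
  have "\<not> [4 = 0] (mod int p)"
  proof
    assume "[4 = 0] (mod int p)"
    then have "int p dvd 2 * 2" by (simp add: cong_0_iff)
    then have "int p dvd 2" using assms(1) by (metis prime_dvd_mult_iff prime_nat_int_transfer)
    then show False using assms(2) zdvd_imp_le by fastforce
  qed
  moreover have "QuadRes (int p) 4" unfolding QuadRes_def by (intro exI[of _ 2]) simp
  ultimately show ?thesis by (simp add: Legendre_def)
qed

lemma Legendre_nonzero_square: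
  "\<not> [a = 0] (mod p) \<Longrightarrow> Legendre a p * Legendre a p = 1"
  by (simp add: Legendre_def)

lemma Legendre_mod_3: "Legendre a 3 = (if a mod 3 = 0 then 0 else if a mod 3 = 1 then 1 else -1)"
proof -
  have "y ^ 2 mod 3 \<in> {0, 1}" for y :: int
  proof -
    have "y mod 3 \<in> {0, 1, 2}" by auto
    moreover have "y ^ 2 mod 3 = (y mod 3) ^ 2 mod 3" by (simp add: power_mod)
    ultimately show ?thesis by auto
  qed
  then have "QuadRes 3 a \<longrightarrow> a mod 3 \<in> {0, 1}" unfolding QuadRes_def cong_def by metis
  moreover have "a mod 3 = 1 \<Longrightarrow> QuadRes 3 a"
    unfolding QuadRes_def cong_def by (intro exI[of _ 1]) simp
  ultimately show ?thesis by (auto simp: Legendre_def cong_def)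
qed

lemma Legendre_mod_7:
  "Legendre a 7 = (if a mod 7 = 0 then 0 else if a mod 7 \<in> {1, 2, 4} then 1 else -1)"
proof -
  have "y ^ 2 mod 7 \<in> {0, 1, 2, 4}" for y :: int
  proof -
    have "y mod 7 \<in> {0, 1, 2, 3, 4, 5, 6}" by auto
    moreover have "y ^ 2 mod 7 = (y mod 7) ^ 2 mod 7" by (simp add: power_mod)
    ultimately show ?thesis by auto
  qed
  then have "QuadRes 7 a \<longrightarrow> a mod 7 \<in> {0, 1, 2, 4}" unfolding QuadRes_def cong_def by metis
  moreover have "a mod 7 = 1 \<Longrightarrow> QuadRes 7 a" unfolding QuadRes_def cong_def by (intro exI[of _ 1]) simp
  moreover have "a mod 7 = 2 \<Longrightarrow> QuadRes 7 a" unfolding QuadRes_def cong_def by (intro exI[of _ 3]) simp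
  moreover have "a mod 7 = 4 \<Longrightarrow> QuadRes 7 a" unfolding QuadRes_def cong_def by (intro exI[of _ 2]) simp
  ultimately show ?thesis by (auto simp: Legendre_def cong_def)
qed

text \<open>For a prime \<open>q \<equiv> 3 (mod 4)\<close> the signs in the reciprocity law and in the first supplement cancel.\<close>
lemma Legendre_minus_reciprocity:
  assumes "prime p" "2 < p" "prime q" "2 < q" "p \<noteq> q" "q mod 4 = 3"
  shows "Legendre (- int q) (int p) = Legendre (int p) (int q)"
proof -
  have "odd ((q - 1) div 2)" using assms(6) by presburger
  then have QR: "Legendre (int p) (int q) * Legendre (int q) (int p) = (-1) ^ ((p - 1) div 2)"
    using Quadratic_Reciprocity[OF assms(1-5)] by (simp add: power_mult uminus_power_if)
  have "\<not> int p dvd int q" using assms primes_dvd_imp_eq by (metis of_nat_dvd_iff)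
  then have sq: "Legendre (int q) (int p) * Legendre (int q) (int p) = 1"
    by (intro Legendre_nonzero_square) (simp add: cong_0_iff)
  have "Legendre (- int q) (int p) = Legendre (-1) (int p) * Legendre (int q) (int p)"
    using Legendre_mult[OF assms(1,2), of "-1" "int q"] by simp
  also have "\<dots> = Legendre (int p) (int q) * (Legendre (int q) (int p) * Legendre (int q) (int p))"
    unfolding Legendre_minus_1[OF assms(1,2)] QR[symmetric] by (simp only: mult.assoc)
  finally show ?thesis using sq by simp
qed

text \<open>Gauss's lemma, applied to the positive representative p - 2 of -2. The product x (p - 2)
  reduces to p - 2x, which exceeds (p - 1)/2 exactly for x \<le> p/4.\<close>

lemma Legendre_minus_2:
  assumes "prime p" "2 < p"
  shows "Legendre (-2) (int p) = (-1) ^ (p div 4)"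
proof -
  have odd: "odd p" using assms prime_odd_nat by blast
  have ncong: "\<not> [int p - 2 = 0] (mod int p)"
  proof
    assume "[int p - 2 = 0] (mod int p)"
    then have "int p dvd int p - 2" by (simp add: cong_0_iff)
    then have "int p \<le> int p - 2" using assms by (intro zdvd_imp_le) auto
    then show False by simp
  qed
  interpret GAUSS p "int p - 2"
    using assms ncong by unfold_locales auto
  have md: "x * (int p - 2) mod int p = int p - 2 * x" if "0 < x" "x \<le> (int p - 1) div 2" for x
  proof -
    have "x * (int p - 2) = (int p - 2 * x) + (x - 1) * int p" by (simp add: algebra_simps)
    then have "x * (int p - 2) mod int p = (int p - 2 * x) mod int p" by simp
    also have "\<dots> = int p - 2 * x" using that odd by (intro mod_pos_pos_trivial) presburger+
    finally show ?thesis .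
  qed
  have "E = (\<lambda>x. int p - 2 * x) ` {0<..int p div 4}"
  proof (intro equalityI subsetI)
    fix y assume "y \<in> E"
    then obtain x where x: "0 < x" "x \<le> (int p - 1) div 2" "y = x * (int p - 2) mod int p" "(int p - 1) div 2 < y"
      unfolding E_def C_def B_def A_def by auto
    with md have y: "y = int p - 2 * x" by simp
    with x(4) have "x \<le> int p div 4" by presburger
    with x(1) y show "y \<in> (\<lambda>x. int p - 2 * x) ` {0<..int p div 4}" by simp
  next
    fix y assume "y \<in> (\<lambda>x. int p - 2 * x) ` {0<..int p div 4}"
    then obtain x where x: "0 < x" "x \<le> int p div 4" "y = int p - 2 * x" by auto
    then have xA: "x \<le> (int p - 1) div 2" by presburger
    have "(int p - 1) div 2 < y" using x(2,3) odd by presburger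
    moreover have "y = x * (int p - 2) mod int p" using md[OF x(1) xA] x by simp
    ultimately show "y \<in> E" unfolding E_def C_def B_def A_def using x xA by auto
  qed
  then have "card E = card {0<..int p div 4}" by (simp add: card_image inj_on_def)
  also have "\<dots> = p div 4" by (simp add: zdiv_int[symmetric, of p 4, simplified])
  finally have "card E = p div 4" .
  moreover have "Legendre (-2) (int p) = Legendre (int p - 2) (int p)"
    by (intro Legendre_cong) (simp add: cong_iff_dvd_diff)
  ultimately show ?thesis using gauss_lemma by simp
qed

text \<open>The character \<open>n \<mapsto> (-d/n)\<close> on odd \<open>n\<close>, extended by zero to even \<open>n\<close>, as a table of residues
  modulo \<open>odd_char_modulus d\<close>.\<close>
definition odd_char_modulus :: "nat \<Rightarrow> nat" where
  "odd_char_modulus d = (if d = 2 then 8 else if d = 3 then 6 else if d = 7 then 14 else 4)"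

definition odd_char_table :: "nat \<Rightarrow> nat \<Rightarrow> int" where
  "odd_char_table d r =
    (if d = 2 then (if r \<in> {1, 3} then 1 else if r \<in> {5, 7} then -1 else 0)
     else if d = 3 then (if r = 1 then 1 else if r = 5 then -1 else 0)
     else if d = 7 then (if r \<in> {1, 9, 11} then 1 else if r \<in> {3, 5, 13} then -1 else 0)
     else (if r = 1 then 1 else if r = 3 then -1 else 0))"

definition odd_char :: "nat \<Rightarrow> nat \<Rightarrow> int" where
  "odd_char d n = odd_char_table d (n mod odd_char_modulus d)"

section \<open>Verification of the residue tables and their agreement with the symbols\<close>

lemma residue_ranges:
  "{..<4} = {0, 1, 2, 3::nat}" "{..<6} = {0, 1, 2, 3, 4, 5::nat}"
      "{..<8} = {0, 1, 2, 3, 4, 5, 6, 7::nat}"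
      "{..<14} = {0, 1, 2, 3, 4, 5, 6, 7, 8, 9, 10, 11, 12, 13::nat}"
  unfolding atLeast_upt by code_simp+

lemma odd_char_mult:
  assumes "d \<in> {1, 2, 3, 4, 7}"
  shows "odd_char d (m * n) = odd_char d m * odd_char d n"
proof -
  define P where "P d q R \<longleftrightarrow> (\<forall>a\<in>R. \<forall>b\<in>R. odd_char_table d (a * b mod q) = odd_char_table d a * odd_char_table d b)"
    for d q and R :: "nat set"
  have "P 1 4 {..<4}" "P 2 8 {..<8}" "P 3 6 {..<6}" "P 4 4 {..<4}" "P 7 14 {..<14}"
    by (simp only: residue_ranges P_def ball_simps, simp add: odd_char_table_def)+
  with assms have "P d (odd_char_modulus d) {..<odd_char_modulus d}"
    by (auto simp: odd_char_modulus_def)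
  moreover have "m mod odd_char_modulus d \<in> {..<odd_char_modulus d}" "n mod odd_char_modulus d \<in> {..<odd_char_modulus d}"
    by (auto simp: odd_char_modulus_def)
  ultimately have "odd_char_table d ((m mod odd_char_modulus d) * (n mod odd_char_modulus d) mod odd_char_modulus d)
      = odd_char_table d (m mod odd_char_modulus d) * odd_char_table d (n mod odd_char_modulus d)"
    unfolding P_def by blast
  then show ?thesis by (simp add: odd_char_def mod_mult_eq)
qed

lemma odd_char_1: "odd_char d 1 = 1" and odd_char_0: "odd_char d 0 = 0"
proof -
  have "1 mod odd_char_modulus d = 1" by (simp add: odd_char_modulus_def)
  then show "odd_char d 1 = 1" unfolding odd_char_def by (simp only: odd_char_table_def) simp
  show "odd_char d 0 = 0" unfolding odd_char_def by (simp add: odd_char_table_def)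
qed

lemma abs_odd_char_le: "\<bar>odd_char d n\<bar> \<le> 1"
proof -
  have "\<bar>odd_char_table d r\<bar> \<le> 1" for r by (simp add: odd_char_table_def)
  then show ?thesis by (simp add: odd_char_def)
qed

text \<open>The table sums to zero over a full period, so only initial segments of one period
  matter. The bound is 2 for d = 2 because the residues 1 and 3 both carry the sign +1.\<close>

lemma sum_odd_char_bound:
  assumes "d \<in> {1, 2, 3, 4, 7}"
  shows "\<bar>\<Sum>k<n. odd_char d k\<bar> \<le> (if d = 2 then 2 else 1)"
proof -
  define q where "q = odd_char_modulus d"
  have q: "q > 0" by (simp add: q_def odd_char_modulus_def)
  define P where "P d q (B :: int) \<longleftrightarrow> (\<Sum>k<q. odd_char_table d k) = 0
      \<and> (\<forall>n\<in>{..<q}. \<bar>\<Sum>k<n. odd_char_table d k\<bar> \<le> B)" for d q B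
  have "P 1 4 1" "P 2 8 2" "P 3 6 1" "P 4 4 1" "P 7 14 1"
    by (simp only: P_def residue_ranges ball_simps,
        simp add: odd_char_table_def lessThan_nat_numeral lessThan_Suc)+
  with assms have check: "P d q (if d = 2 then 2 else 1)" by (auto simp: q_def odd_char_modulus_def)
  have table: "(\<Sum>k<n. odd_char d k) = (\<Sum>k<n. odd_char_table d k)" if "n \<le> q" for n
    using that by (intro sum.cong) (auto simp: odd_char_def q_def)
  have zero: "(\<Sum>k<q. odd_char d k) = 0"
    using check unfolding table[OF order_refl] P_def by blast
  have small: "\<bar>\<Sum>k<n. odd_char d k\<bar> \<le> (if d = 2 then 2 else 1)" if "n < q" for n
    using check that unfolding table[OF less_imp_le[OF that]] P_def by blast
  show ?thesis
  proof (induction n rule: less_induct)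
    case (less n)
    show ?case
    proof (cases "n < q")
      case False
      have "(\<Sum>k<n. odd_char d k) = (\<Sum>k<q. odd_char d k) + (\<Sum>k\<in>{q..<n}. odd_char d k)"
        using False by (simp add: lessThan_atLeast0 sum.atLeastLessThan_concat)
      also have "(\<Sum>k\<in>{q..<n}. odd_char d k) = (\<Sum>k<n-q. odd_char d (k + q))"
        using False sum.shift_bounds_nat_ivl[of "odd_char d" 0 q "n - q"] by (simp add: lessThan_atLeast0)
      also have "\<dots> = (\<Sum>k<n-q. odd_char d k)" by (simp add: odd_char_def q_def)
      finally show ?thesis using less.IH[of "n - q"] False q zero by simp
    qed (rule small)
  qed
qed

text \<open>The supplementary laws settle d = 1, 2, 4. For d = 3 and d = 7, reciprocity reduces to
  squares modulo d, and together with oddness of p this determines the residue modulo 2d. The case p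
  = d, which reciprocity excludes, is checked directly.\<close>

lemma Legendre_eq_odd_char:
  assumes d: "d \<in> {1, 2, 3, 4, 7}" and p: "prime p" "2 < p"
  shows "Legendre (- int d) (int p) = odd_char d p"
proof -
  have odd: "odd p" using p prime_odd_nat by blast
  have m1: "Legendre (-1) (int p) = (if p mod 4 = 1 then 1 else -1)"
  proof (cases "p mod 4 = 1")
    case True
    then have "even ((p - 1) div 2)" by presburger
    with True show ?thesis by (simp add: Legendre_minus_1[OF p])
  next
    case False
    with odd have "p mod 4 = 3" by presburger
    then have "odd ((p - 1) div 2)" by presburger
    with False show ?thesis by (simp add: Legendre_minus_1[OF p])
  qed
  have mod4: "p mod 4 = 1 \<or> p mod 4 = 3" using odd by presburger
  consider "d = 1" | "d = 2" | "d = 3" | "d = 4" | "d = 7" using d by auto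
  then show ?thesis
  proof cases
    case 1
    then show ?thesis using m1 mod4 by (auto simp: odd_char_def odd_char_table_def odd_char_modulus_def)
  next
    case 4
    have "Legendre (-4) (int p) = Legendre (-1) (int p)"
      using Legendre_mult[OF p, of "-1" 4] Legendre_4[OF p] by simp
    then show ?thesis using 4 m1 mod4 by (auto simp: odd_char_def odd_char_table_def odd_char_modulus_def)
  next
    case 2
    have "p mod 8 = 1 \<or> p mod 8 = 3 \<or> p mod 8 = 5 \<or> p mod 8 = 7" using odd by presburger
    moreover have "p mod 8 = 1 \<or> p mod 8 = 3 \<Longrightarrow> even (p div 4)" by presburger
    moreover have "p mod 8 = 5 \<or> p mod 8 = 7 \<Longrightarrow> odd (p div 4)" by presburger
    ultimately show ?thesis using 2 Legendre_minus_2[OF p]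
      by (auto simp: odd_char_def odd_char_table_def odd_char_modulus_def)
  next
    case 3
    show ?thesis
    proof (cases "p = 3")
      case False
      have "prime (3::nat)" by simp
      from Legendre_minus_reciprocity[OF p this] False
      have "Legendre (- 3) (int p) = Legendre (int p) 3" by simp
      also have "\<dots> = (if p mod 3 = 0 then 0 else if p mod 3 = 1 then 1 else -1)"
        by (simp add: Legendre_mod_3 zmod_int[symmetric, of p 3, simplified])
      also have "\<dots> = odd_char d p"
      proof -
        have "\<not> 3 dvd p" using False p \<open>prime 3\<close> primes_dvd_imp_eq by blast
        define r where "r = p mod 6"
        have "r < 6" by (simp add: r_def)
        then have "r \<in> {0, 1, 2, 3, 4, 5}" by auto
        moreover have r3: "p mod 3 = r mod 3" by (simp add: r_def mod_mod_cancel)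
        then have "r mod 3 \<noteq> 0" using \<open>\<not> 3 dvd p\<close> by (simp only: dvd_eq_mod_eq_0 not_False_eq_True)
        moreover have "r mod 2 = 1"
          using odd unfolding r_def odd_iff_mod_2_eq_one by (simp add: mod_mod_cancel)
        ultimately have "r = 1 \<or> r = 5" by auto
        then show ?thesis using 3 unfolding r3 odd_char_def odd_char_modulus_def odd_char_table_def
          by (auto simp: r_def[symmetric])
      qed
      finally show ?thesis using 3 by simp
    qed (use 3 in \<open>auto simp: odd_char_def odd_char_table_def odd_char_modulus_def Legendre_mod_3\<close>)
  next
    case 5
    show ?thesis
    proof (cases "p = 7")
      case False
      have "prime (7::nat)" by simp
      from Legendre_minus_reciprocity[OF p this] False
      have "Legendre (- 7) (int p) = Legendre (int p) 7" by simp
      also have "\<dots> = (if p mod 7 = 0 then 0 else if p mod 7 \<in> {1, 2, 4} then 1 else -1)"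
        by (simp add: Legendre_mod_7 zmod_int[symmetric, of p 7, simplified])
      also have "\<dots> = odd_char d p"
      proof -
        have "\<not> 7 dvd p" using False p \<open>prime 7\<close> primes_dvd_imp_eq by blast
        define r where "r = p mod 14"
        have "r < 14" by (simp add: r_def)
        then have "r \<in> {0, 1, 2, 3, 4, 5, 6, 7, 8, 9, 10, 11, 12, 13}"
          unfolding residue_ranges[symmetric] by simp
        moreover have r7: "p mod 7 = r mod 7" by (simp add: r_def mod_mod_cancel)
        then have "r mod 7 \<noteq> 0" using \<open>\<not> 7 dvd p\<close> by (simp only: dvd_eq_mod_eq_0 not_False_eq_True)
        moreover have "r mod 2 = 1"
          using odd unfolding r_def odd_iff_mod_2_eq_one by (simp add: mod_mod_cancel)
        ultimately have "r \<in> {1, 3, 5, 9, 11, 13}" by auto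
        then show ?thesis using 5 unfolding r7 odd_char_def odd_char_modulus_def odd_char_table_def
          by (auto simp: r_def[symmetric])
      qed
      finally show ?thesis using 5 by simp
    qed (use 5 in \<open>auto simp: odd_char_def odd_char_table_def odd_char_modulus_def Legendre_mod_7\<close>)
  qed
qed

lemma Jacobi_eq_odd_char:
  assumes d: "d \<in> {1, 2, 3, 4, 7}" and n: "odd n"
  shows "Jacobi (- int d) n = odd_char d n"
proof -
  have pow: "odd_char d (m ^ k) = odd_char d m ^ k" for m k
    by (induction k) (simp_all add: odd_char_1[simplified] odd_char_mult[OF d])
  have prod: "odd_char d (\<Prod>x\<in>A. f x) = (\<Prod>x\<in>A. odd_char d (f x))" if "finite A" for A and f :: "nat \<Rightarrow> nat"
    using that by induction (simp_all add: odd_char_1[simplified] odd_char_mult[OF d])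
  have "n > 0" using n by (auto intro: Nat.gr0I)
  have "Jacobi (- int d) n = (\<Prod>p\<in>prime_factors n. odd_char d p ^ multiplicity p n)"
    unfolding Jacobi_def
  proof (rule prod.cong[OF refl])
    fix p assume "p \<in> prime_factors n"
    then have p: "prime p" "p dvd n" by auto
    with n have "p \<noteq> 2" by auto
    with p have "2 < p" using prime_ge_2_nat[of p] by simp
    then show "Legendre (- int d) (int p) ^ multiplicity p n = odd_char d p ^ multiplicity p n"
      using Legendre_eq_odd_char[OF d p(1)] by simp
  qed
  also have "\<dots> = odd_char d (\<Prod>p\<in>prime_factors n. p ^ multiplicity p n)"
    by (simp add: prod pow)
  also have "(\<Prod>p\<in>prime_factors n. p ^ multiplicity p n) = n"
    using \<open>n > 0\<close> by (rule prime_factorization_nat[symmetric])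
  finally show ?thesis .
qed

section \<open>Local densities\<close>

text \<open>The difference from the fixed point \<alpha> / (1 - \<beta>) is multiplied by \<beta> at
  every step.\<close>

lemma affine_recurrence_tendsto:
  fixes u :: "nat \<Rightarrow> real"
  assumes rec: "\<And>k. k \<ge> K \<Longrightarrow> u (Suc k) = \<alpha> + \<beta> * u k" and "\<bar>\<beta>\<bar> < 1"
  shows "u \<longlonglongrightarrow> \<alpha> / (1 - \<beta>)"
proof -
  define l where "l = \<alpha> / (1 - \<beta>)"
  have l: "l = \<alpha> + \<beta> * l" using assms(2) by (simp add: l_def field_simps)
  have "u (k + K) = l + \<beta> ^ k * (u K - l)" for k
  proof (induction k)
    case (Suc k)
    have "u (Suc k + K) = \<alpha> + \<beta> * (l + \<beta> ^ k * (u K - l))" using rec[of "k + K"] Suc by simp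
    also have "\<dots> = (\<alpha> + \<beta> * l) + \<beta> ^ Suc k * (u K - l)" by (simp add: algebra_simps)
    finally show ?case using l by simp
  qed simp
  moreover have "(\<lambda>k. l + \<beta> ^ k * (u K - l)) \<longlonglongrightarrow> l + 0 * (u K - l)"
    using assms(2) by (intro tendsto_intros LIMSEQ_power_zero) auto
  ultimately have "(\<lambda>k. u (k + K)) \<longlonglongrightarrow> l" by simp
  then show ?thesis unfolding l_def by (rule LIMSEQ_offset)
qed

section \<open>Counting represented residues and scaling the modulus\<close>

lemma card_residue_classes:
  assumes "0 < m" "m dvd q" "U \<subseteq> {0..<m}"
  shows "card {a\<in>{0..<q}. a mod m \<in> U} = q div m * card U"
proof -
  obtain t where t: "q = m * t" using assms(2) by blast
  have "bij_betw (\<lambda>(r, j). j * m + r) (U \<times> {0..<t}) {a\<in>{0..<q}. a mod m \<in> U}"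
  proof (rule bij_betw_byWitness[where f' = "\<lambda>a. (a mod m, a div m)"])
    show "(\<lambda>(r, j). j * m + r) ` (U \<times> {0..<t}) \<subseteq> {a\<in>{0..<q}. a mod m \<in> U}"
    proof clarify
      fix r j assume "r \<in> U" "j \<in> {0..<t}"
      then have r: "r < m" and j: "j < t" using assms(3) by auto
      have "j * m + r < Suc j * m" using r by simp
      also have "\<dots> \<le> t * m" using j by (intro mult_le_mono1) simp
      finally show "j * m + r \<in> {0..<q} \<and> (j * m + r) mod m \<in> U"
        using r \<open>r \<in> U\<close> by (simp add: t mult.commute)
    qed
    show "(\<lambda>a. (a mod m, a div m)) ` {a\<in>{0..<q}. a mod m \<in> U} \<subseteq> U \<times> {0..<t}"
      by (auto simp: t less_mult_imp_div_less mult.commute)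
  qed (use assms in auto)
  then have "card {a\<in>{0..<q}. a mod m \<in> U} = card (U \<times> {0..<t})" by (simp add: bij_betw_same_card)
  then show ?thesis using assms(1) by (simp add: t card_cartesian_product)
qed

definition rep_mod :: "nat \<Rightarrow> nat \<Rightarrow> nat \<Rightarrow> bool" where
  "rep_mod d q a \<longleftrightarrow> (\<exists>x y :: int. [int a = x^2 + int d * y^2] (mod int q))"

definition rep_count :: "nat \<Rightarrow> nat \<Rightarrow> nat" where
  "rep_count d q = card {a\<in>{0..<q}. rep_mod d q a}"

lemma rep_mod_dvd: "rep_mod d q a \<longleftrightarrow> (\<exists>x y :: int. int q dvd int a - (x^2 + int d * y^2))"
  by (simp add: rep_mod_def cong_iff_dvd_diff)

text \<open>Represented residues modulo c q are either multiples of c, matched with represented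
  residues modulo q, or lie in the classes \<open>U\<close> modulo \<open>m\<close>. The second form
  \<open>d'\<close> and a composite c are allowed because d = 4 reduces to d = 1 with c = 4.\<close>

lemma rep_count_step:
  assumes scale: "\<And>b. rep_mod d (c * q) (c * b) \<longleftrightarrow> rep_mod d' q b"
    and units: "\<And>a. \<not> c dvd a \<Longrightarrow> rep_mod d (c * q) a \<longleftrightarrow> a mod m \<in> U"
    and "0 < c" "0 < m" "m dvd c * q" "c dvd m" "U \<subseteq> {0..<m}" "\<And>r. r \<in> U \<Longrightarrow> \<not> c dvd r"
  shows "rep_count d (c * q) = c * q div m * card U + rep_count d' q"
proof -
  have U: "\<not> c dvd a" if "a mod m \<in> U" for a
    using assms(6,8) that by (metis dvd_mod_iff)
  have "{a\<in>{0..<c*q}. rep_mod d (c * q) a}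
      = {a\<in>{0..<c*q}. a mod m \<in> U} \<union> (\<lambda>b. c * b) ` {b\<in>{0..<q}. rep_mod d' q b}" (is "_ = ?A \<union> ?B")
  proof (intro equalityI subsetI)
    fix a assume a: "a \<in> {a\<in>{0..<c*q}. rep_mod d (c * q) a}"
    show "a \<in> ?A \<union> ?B"
    proof (cases "c dvd a")
      case True
      then obtain b where "a = c * b" by blast
      with a scale have "b \<in> {b\<in>{0..<q}. rep_mod d' q b}" by auto
      with \<open>a = c * b\<close> show ?thesis by blast
    next
      case False
      with a units show ?thesis by auto
    qed
  next
    fix a assume "a \<in> ?A \<union> ?B"
    then show "a \<in> {a\<in>{0..<c*q}. rep_mod d (c * q) a}"
      using scale units U \<open>0 < c\<close> by auto
  qed
  moreover have "?A \<inter> ?B = {}" by (auto dest!: U)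
  ultimately have "rep_count d (c * q) = card ?A + card ?B"
    unfolding rep_count_def by (simp add: card_Un_disjoint)
  also have "card ?A = c * q div m * card U"
    using assms by (intro card_residue_classes) auto
  also have "card ?B = rep_count d' q"
    unfolding rep_count_def using \<open>0 < c\<close> by (intro card_image) (auto simp: inj_on_def)
  finally show ?thesis .
qed

text \<open>If d divides x^2 + d y^2, then x = d z, and taking out d gives y^2 + d z^2: the two
  variables exchange roles.\<close>

lemma rep_mod_scale_prime:
  assumes "prime d"
  shows "rep_mod d (d * q) (d * b) \<longleftrightarrow> rep_mod d q b"
proof
  assume "rep_mod d (d * q) (d * b)"
  then obtain x y :: int where xy: "int (d * q) dvd int (d * b) - (x^2 + int d * y^2)"
    unfolding rep_mod_dvd by blast
  have d: "int d dvd int (d * b) - (x^2 + int d * y^2)" by (rule dvd_trans[OF _ xy]) simp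
  have "int d dvd x^2"
    using dvd_diff[of "int d" "int d * (int b - y^2)" "int (d * b) - (x^2 + int d * y^2)"] d
    by (simp add: algebra_simps)
  then have "int d dvd x" using assms by (metis prime_dvd_power prime_nat_int_transfer)
  then obtain z where z: "x = int d * z" by blast
  have "int d * int q dvd int d * (int b - (y^2 + int d * z^2))"
    using xy by (simp add: z algebra_simps power2_eq_square)
  then have "int q dvd int b - (y^2 + int d * z^2)" using prime_gt_0_nat[OF assms] by simp
  then show "rep_mod d q b" unfolding rep_mod_dvd by blast
next
  assume "rep_mod d q b"
  then obtain x y :: int where xy: "int q dvd int b - (x^2 + int d * y^2)" unfolding rep_mod_dvd by blast
  then have "int d * int q dvd int d * (int b - (x^2 + int d * y^2))" by (rule mult_dvd_mono[OF dvd_refl])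
  also have "int d * (int b - (x^2 + int d * y^2)) = int (d * b) - ((int d * y)^2 + int d * x^2)"
    by (simp add: algebra_simps power2_eq_square)
  finally show "rep_mod d (d * q) (d * b)" unfolding rep_mod_dvd by (metis of_nat_mult)
qed

text \<open>The identity (u + v)^2 + (u - v)^2 = 2 (u^2 + v^2), read in both directions. An even sum
  of two squares forces x and y to have equal parity.\<close>

lemma rep_mod_scale_1_2: "rep_mod 1 (2 * q) (2 * b) \<longleftrightarrow> rep_mod 1 q b"
proof
  assume "rep_mod 1 (2 * q) (2 * b)"
  then obtain x y :: int where xy: "2 * int q dvd 2 * int b - (x^2 + y^2)" unfolding rep_mod_dvd by auto
  then have "2 dvd 2 * int b - (x^2 + y^2)" using dvd_mult_left by blast
  then have "even (x + y)" by simp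
  then obtain u where u: "x + y = 2 * u" by blast
  define v where "v = x - u"
  have "x = u + v" "y = u - v" using u by (auto simp: v_def)
  then have "2 * int b - (x^2 + y^2) = 2 * (int b - (u^2 + v^2))"
    by (simp only:) (simp add: algebra_simps power2_eq_square)
  with xy have "2 * int q dvd 2 * (int b - (u^2 + v^2))" by (simp only:)
  then have "int q dvd int b - (u^2 + int 1 * v^2)" by (subst (asm) dvd_times_left_cancel_iff) simp_all
  then show "rep_mod 1 q b" unfolding rep_mod_dvd by blast
next
  assume "rep_mod 1 q b"
  then obtain x y :: int where "int q dvd int b - (x^2 + y^2)" unfolding rep_mod_dvd by auto
  then have "2 * int q dvd 2 * (int b - (x^2 + y^2))" by (rule mult_dvd_mono[OF dvd_refl])
  also have "2 * (int b - (x^2 + y^2)) = int (2 * b) - ((x + y)^2 + int 1 * (x - y)^2)"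
    by (simp add: algebra_simps power2_eq_square)
  finally show "rep_mod 1 (2 * q) (2 * b)" unfolding rep_mod_dvd by (metis of_nat_mult of_nat_numeral)
qed

lemma rep_mod_scale_4: "rep_mod 4 (4 * q) (4 * b) \<longleftrightarrow> rep_mod 1 q b"
proof
  assume "rep_mod 4 (4 * q) (4 * b)"
  then obtain x y :: int where xy: "4 * int q dvd 4 * int b - (x^2 + 4 * y^2)" unfolding rep_mod_dvd by auto
  have "2 dvd 4 * int b - (x^2 + 4 * y^2)" by (rule dvd_trans[OF _ xy]) simp
  then have "even x" by simp
  then obtain u where u: "x = 2 * u" by blast
  have "4 * int b - (x^2 + 4 * y^2) = 4 * (int b - (u^2 + y^2))"
    by (simp add: u algebra_simps power2_eq_square)
  with xy have "4 * int q dvd 4 * (int b - (u^2 + y^2))" by (simp only:)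
  then have "int q dvd int b - (u^2 + int 1 * y^2)" by (subst (asm) dvd_times_left_cancel_iff) simp_all
  then show "rep_mod 1 q b" unfolding rep_mod_dvd by blast
next
  assume "rep_mod 1 q b"
  then obtain x y :: int where "int q dvd int b - (x^2 + y^2)" unfolding rep_mod_dvd by auto
  then have "4 * int q dvd 4 * (int b - (x^2 + y^2))" by (rule mult_dvd_mono[OF dvd_refl])
  also have "4 * (int b - (x^2 + y^2)) = int (4 * b) - ((2 * x)^2 + int 4 * y^2)"
    by (simp add: algebra_simps power2_eq_square)
  finally show "rep_mod 4 (4 * q) (4 * b)" unfolding rep_mod_dvd by (metis of_nat_mult of_nat_numeral)
qed

text \<open>The induction starts at modulus 8 with the root 1. If the quotient c in x^2 - a =
  2^(k+3) c is odd, then adding 2^(k+2) to x adds the odd x to c modulo 2, which makes the quotient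
  even.\<close>

lemma square_mod_power_2:
  fixes a :: int
  assumes "a mod 8 = 1"
  shows "\<exists>x. 2 ^ k dvd x^2 - a"
proof -
  have "\<exists>x. 2 ^ (k + 3) dvd x^2 - a" for k
  proof (induction k)
    case 0
    have "8 dvd 1 - a" using assms by presburger
    then show ?case by (intro exI[of _ 1]) simp
  next
    case (Suc k)
    then obtain x c where c: "x^2 - a = 2 ^ (k + 3) * c" by blast
    have "odd a" using assms by presburger
    moreover have "even (x^2 - a)" unfolding c by simp
    ultimately have "odd x" by simp
    show ?case
    proof (cases "even c")
      case True
      then obtain e where "c = 2 * e" by blast
      then have "x^2 - a = 2 ^ (Suc k + 3) * e" using c by (simp add: power_add)
      then show ?thesis by (intro exI[of _ x]) simp
    next
      case False
      with \<open>odd x\<close> have "even (c + x)" by simp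
      then obtain e where e: "c + x = 2 * e" by blast
      have "(x + 2 ^ (k + 2))^2 - a = (x^2 - a) + 2 ^ (k + 3) * x + 2 ^ (k + 4) * 2 ^ k"
        by (simp add: power2_eq_square power_add algebra_simps)
      also have "\<dots> = 2 ^ (k + 3) * (c + x) + 2 ^ (k + 4) * 2 ^ k"
        unfolding c by (simp add: algebra_simps)
      finally have "(x + 2 ^ (k + 2))^2 - a = 2 ^ (Suc k + 3) * (e + 2 ^ k)"
        unfolding e by (simp add: power_add algebra_simps)
      then show ?thesis by (intro exI[of _ "x + 2 ^ (k + 2)"]) simp
    qed
  qed
  from this[of k] obtain x where "2 ^ (k + 3) dvd x^2 - a" by blast
  moreover have "(2::int) ^ k dvd 2 ^ (k + 3)" by (rule le_imp_power_dvd) simp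
  ultimately show ?thesis using dvd_trans by blast
qed

text \<open>Hensel lifting: as p is odd and a is a unit, 2x is invertible modulo p, and a Newton
  step with that inverse raises the exponent by one.\<close>

lemma square_mod_odd_prime_power:
  fixes a x\<^sub>0 :: int
  assumes p: "prime p" "2 < p" and start: "int p dvd x\<^sub>0^2 - a" and unit: "\<not> int p dvd a"
  shows "\<exists>x. int p ^ k dvd x^2 - a"
proof -
  have "\<exists>x. int p ^ Suc k dvd x^2 - a" for k
  proof (induction k)
    case 0
    then show ?case using start by auto
  next
    case (Suc k)
    then obtain x c where c: "x^2 - a = int p ^ Suc k * c" by blast
    have "\<not> int p dvd x"
    proof
      assume "int p dvd x"
      then have "int p dvd x^2" by (simp add: power2_eq_square)
      moreover have "int p dvd x^2 - a" unfolding c by simp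
      ultimately have "int p dvd x^2 - (x^2 - a)" by (rule dvd_diff)
      with unit show False by simp
    qed
    moreover have "\<not> int p dvd 2" using p(2) zdvd_imp_le by fastforce
    ultimately have "\<not> int p dvd 2 * x" using p(1) by (simp add: prime_dvd_mult_iff)
    then have "coprime (2 * x) (int p)"
      using p(1) by (metis coprime_commute prime_imp_coprime prime_nat_int_transfer)
    then obtain i where "[2 * x * i = 1] (mod int p)" using cong_solve_coprime_int by blast
    then have "int p dvd 2 * x * i - 1" by (simp add: cong_iff_dvd_diff)
    then obtain j where j: "2 * x * i - 1 = int p * j" by blast
    define y where "y = x - int p ^ Suc k * (c * i)"
    have "y^2 - a = (x^2 - a) - int p ^ Suc k * c * (2 * x * i) + int p ^ Suc k * int p ^ Suc k * (c * i)^2"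
      by (simp add: y_def power2_eq_square algebra_simps)
    also have "\<dots> = - (int p ^ Suc k * c * (2 * x * i - 1)) + int p ^ Suc k * int p ^ Suc k * (c * i)^2"
      unfolding c by (simp add: algebra_simps)
    also have "\<dots> = int p ^ Suc (Suc k) * (- c * j + int p ^ k * (c * i)^2)"
      unfolding j by (simp add: algebra_simps)
    finally show ?case by (intro exI[of _ y]) simp
  qed
  from this[of k] obtain x where "int p ^ Suc k dvd x^2 - a" by blast
  moreover have "int p ^ k dvd int p ^ Suc k" by (rule le_imp_power_dvd) simp
  ultimately show ?thesis using dvd_trans by blast
qed

section \<open>Represented units modulo prime powers\<close>

lemma rep_mod_imp_mod_eq:
  assumes "rep_mod d q a" "m dvd q"
  obtains x y :: int where "int (a mod m) = (x^2 mod int m + int d * (y^2 mod int m)) mod int m"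
proof -
  from assms(1) obtain x y :: int where "int q dvd int a - (x^2 + int d * y^2)" unfolding rep_mod_dvd by blast
  with assms(2) have "int m dvd int a - (x^2 + int d * y^2)" using dvd_trans int_dvd_int_iff by blast
  then have "int a mod int m = (x^2 + int d * y^2) mod int m" by (simp add: mod_eq_dvd_iff)
  also have "\<dots> = (x^2 mod int m + int d * (y^2 mod int m)) mod int m"
    by (metis mod_add_left_eq mod_add_right_eq mod_mult_right_eq)
  finally show ?thesis by (intro that) (simp only: zmod_int)
qed

lemma square_mod_4: "(x::int)^2 mod 4 \<in> {0, 1}"
proof -
  have "x mod 4 \<in> {0, 1, 2, 3}" by auto
  moreover have "x^2 mod 4 = (x mod 4)^2 mod 4" by (simp add: power_mod)
  ultimately show ?thesis by auto
qed

lemma square_mod_8: "(x::int)^2 mod 8 \<in> {0, 1, 4}"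
proof -
  have "x mod 8 \<in> {0, 1, 2, 3, 4, 5, 6, 7}" by auto
  moreover have "x^2 mod 8 = (x mod 8)^2 mod 8" by (simp add: power_mod)
  ultimately show ?thesis by auto
qed

text \<open>The difference a - d y^2 is 1 modulo 8, hence a square modulo every power of 2.
  Representability thus reduces to exhibiting one small y.\<close>

lemma rep_mod_power_2I:
  assumes "a mod 8 = (1 + d * y^2) mod 8"
  shows "rep_mod d (2 ^ k) a"
proof -
  have "int a mod 8 = int (1 + d * y^2) mod 8"
    using arg_cong[OF assms, of int] by (simp only: zmod_int of_nat_numeral)
  then have "(int a - int d * (int y)^2) mod 8 = 1 mod 8"
    by (simp only: mod_eq_dvd_iff) (simp add: algebra_simps)
  then have "(int a - int d * (int y)^2) mod 8 = 1" by simp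
  then obtain x where "2 ^ k dvd x^2 - (int a - int d * (int y)^2)" using square_mod_power_2 by blast
  then have "2 ^ k dvd - (x^2 - (int a - int d * (int y)^2))" by (simp only: dvd_minus_iff)
  then have "int (2 ^ k) dvd int a - (x^2 + int d * (int y)^2)" by (simp add: algebra_simps)
  then show ?thesis unfolding rep_mod_dvd by blast
qed

text \<open>Squares modulo 4 exclude the residue 3. Conversely, the residue 1 modulo 8 is reached
  with y = 0, and 5 modulo 8 with y = 2 for d = 1 or y = 1 for d = 4.\<close>

lemma rep_mod_odd_1_4:
  assumes d: "d = 1 \<or> d = 4" and k: "k \<ge> 2" and a: "odd a"
  shows "rep_mod d (2 ^ k) a \<longleftrightarrow> a mod 4 = 1"
proof
  assume "rep_mod d (2 ^ k) a"
  moreover have "4 dvd (2::nat) ^ k" using le_imp_power_dvd[OF k, of 2] by simp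
  ultimately obtain x y :: int where xy: "int (a mod 4) = (x^2 mod int 4 + int d * (y^2 mod int 4)) mod int 4"
    by (rule rep_mod_imp_mod_eq)
  have "int (a mod 4) \<in> {0, 1, 2}"
    unfolding xy using square_mod_4[of x] square_mod_4[of y] d by auto
  then have "a mod 4 = 0 \<or> a mod 4 = 1 \<or> a mod 4 = 2" by auto
  then show "a mod 4 = 1" using a by presburger
next
  assume "a mod 4 = 1"
  then have "a mod 8 = 1 \<or> a mod 8 = 5" by presburger
  then show "rep_mod d (2 ^ k) a"
  proof
    assume "a mod 8 = 1"
    then show ?thesis by (intro rep_mod_power_2I[of _ _ 0]) simp
  next
    assume a5: "a mod 8 = 5"
    show ?thesis
    proof (cases "d = 1")
      case True
      then show ?thesis using a5 by (intro rep_mod_power_2I[of _ _ 2]) simp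
    next
      case False
      then show ?thesis using a5 d by (intro rep_mod_power_2I[of _ _ 1]) simp
    qed
  qed
qed

lemma rep_mod_odd_2:
  assumes k: "k \<ge> 3" and a: "odd a"
  shows "rep_mod 2 (2 ^ k) a \<longleftrightarrow> a mod 8 \<in> {1, 3}"
proof
  assume "rep_mod 2 (2 ^ k) a"
  moreover have "8 dvd (2::nat) ^ k" using le_imp_power_dvd[OF k, of 2] by simp
  ultimately obtain x y :: int where xy: "int (a mod 8) = (x^2 mod int 8 + int 2 * (y^2 mod int 8)) mod int 8"
    by (rule rep_mod_imp_mod_eq)
  have "int (a mod 8) \<in> {0, 1, 2, 3, 4, 6}"
    unfolding xy using square_mod_8[of x] square_mod_8[of y] by auto
  then have "a mod 8 = 0 \<or> a mod 8 = 1 \<or> a mod 8 = 2 \<or> a mod 8 = 3 \<or> a mod 8 = 4 \<or> a mod 8 = 6" by auto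
  then have "a mod 8 = 1 \<or> a mod 8 = 3" using a by presburger
  then show "a mod 8 \<in> {1, 3}" by simp
next
  assume "a mod 8 \<in> {1, 3}"
  then have "a mod 8 = 1 \<or> a mod 8 = 3" by simp
  then show "rep_mod 2 (2 ^ k) a"
  proof
    assume "a mod 8 = 1"
    then show ?thesis by (intro rep_mod_power_2I[of _ _ 0]) simp
  next
    assume "a mod 8 = 3"
    then show ?thesis by (intro rep_mod_power_2I[of _ _ 1]) simp
  qed
qed

text \<open>Modulo d the term d y^2 vanishes, so a must be a square. Conversely, a square root of
  the unit a lifts to every power of d, and y = 0 suffices.\<close>

lemma rep_mod_unit_odd_prime:
  assumes d: "prime d" "2 < d" and k: "k \<ge> 1" and a: "\<not> d dvd a"
  shows "rep_mod d (d ^ k) a \<longleftrightarrow> QuadRes (int d) (int a)"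
proof
  assume "rep_mod d (d ^ k) a"
  moreover have "d dvd d ^ k" using k by simp
  ultimately obtain x y :: int where "int (a mod d) = (x^2 mod int d + int d * (y^2 mod int d)) mod int d"
    by (rule rep_mod_imp_mod_eq)
  then have "[x^2 = int a] (mod int d)" by (simp add: cong_def zmod_int)
  then show "QuadRes (int d) (int a)" unfolding QuadRes_def by blast
next
  assume "QuadRes (int d) (int a)"
  then obtain z where "int d dvd z^2 - int a" unfolding QuadRes_def by (auto simp: cong_iff_dvd_diff)
  then obtain x where "int d ^ k dvd x^2 - int a"
    using square_mod_odd_prime_power[OF d, of z "int a" k] a by auto
  then have "int d ^ k dvd - (x^2 - int a)" by (simp only: dvd_minus_iff)
  then have "int (d ^ k) dvd int a - (x^2 + int d * 0^2)" by simp
  then show "rep_mod d (d ^ k) a" unfolding rep_mod_dvd by blast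
qed

lemma QuadRes_iff_Legendre: "\<not> [a = 0] (mod p) \<Longrightarrow> QuadRes p a \<longleftrightarrow> Legendre a p = 1"
  by (simp add: Legendre_def)

text \<open>Since \<open>- 1/7\<close> is a 2-adic square, the form \<open>x\<^sup>2 + 7 y\<^sup>2\<close> is equivalent to
  \<open>(x - y) (x + y)\<close> modulo powers of 2.\<close>
lemma rep_mod_7_power_2:
  assumes k: "k \<ge> 2"
  shows "rep_mod 7 (2 ^ k) a \<longleftrightarrow> a mod 4 \<in> {0, 1, 3}"
proof
  assume "rep_mod 7 (2 ^ k) a"
  moreover have "4 dvd (2::nat) ^ k" using le_imp_power_dvd[OF k, of 2] by simp
  ultimately obtain x y :: int where xy: "int (a mod 4) = (x^2 mod int 4 + int 7 * (y^2 mod int 4)) mod int 4"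
    by (rule rep_mod_imp_mod_eq)
  have "int (a mod 4) \<in> {0, 1, 3}"
    unfolding xy using square_mod_4[of x] square_mod_4[of y] by auto
  then show "a mod 4 \<in> {0, 1, 3}" by auto
next
  assume "a mod 4 \<in> {0, 1, 3}"
  then have "a mod 4 = 0 \<or> a mod 4 = 1 \<or> a mod 4 = 3" by simp
  then have a: "a mod 4 = 0 \<or> odd a" by presburger
  \<comment> \<open>The exponent is raised by 3 so that the inverse i of 7 also satisfies 7 i = 1
    modulo 8. This gives - i = 1 modulo 8, and - i has a square root modulo 2^k.\<close>
  have "coprime (7::int) (2 ^ (k + 3))" by simp
  from cong_solve_coprime_int[OF this] obtain i :: int where i: "[7 * i = 1] (mod 2 ^ (k + 3))" ..
  have i_dvd: "2 ^ (k + 3) dvd 7 * i - 1" using i by (simp add: cong_iff_dvd_diff)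
  have "(2::int) ^ 3 dvd 2 ^ (k + 3)" by (rule le_imp_power_dvd) simp
  with i_dvd have "2 ^ 3 dvd 7 * i - 1" by (rule dvd_trans[rotated])
  then have "8 dvd 7 * i - 1" by simp
  then have "(- i) mod 8 = 1" by presburger
  then obtain t where "2 ^ k dvd t^2 - (- i)" using square_mod_power_2 by blast
  then have "2 ^ k dvd 7 * (t^2 - (- i))" by (rule dvd_mult)
  moreover have "(2::int) ^ k dvd 7 * i - 1"
    using i_dvd by (rule dvd_trans[rotated]) (simp add: le_imp_power_dvd)
  ultimately have "2 ^ k dvd 7 * (t^2 - (- i)) - (7 * i - 1)" by (rule dvd_diff)
  then have t: "2 ^ k dvd 7 * t^2 + 1" by (simp add: algebra_simps)
  \<comment> \<open>With 7 t^2 = -1 modulo 2^k, the choice y = t z turns 7 y^2 into - z^2. It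
    remains to write a as a difference of two squares, which is possible unless a is 2 modulo
    4.\<close>
  have key: "rep_mod 7 (2 ^ k) a" if "int a = x^2 - z^2" for x z
  proof -
    have "2 ^ k dvd - (z^2 * (7 * t^2 + 1))" using t by simp
    also have "- (z^2 * (7 * t^2 + 1)) = int a - (x^2 + int 7 * (t * z)^2)"
      using that by (simp add: power_mult_distrib algebra_simps)
    finally have "int (2 ^ k) dvd int a - (x^2 + int 7 * (t * z)^2)" by simp
    then show ?thesis unfolding rep_mod_dvd by blast
  qed
  from a show "rep_mod 7 (2 ^ k) a"
  proof
    assume "odd a"
    then obtain b where "a = 2 * b + 1" by (auto elim: oddE)
    then have "int a = (int b + 1)^2 - (int b)^2" by (simp add: power2_eq_square algebra_simps)
    then show ?thesis by (rule key)
  next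
    assume "a mod 4 = 0"
    then obtain b where "a = 4 * b" by auto
    then have "int a = (int b + 1)^2 - (int b - 1)^2" by (simp add: power2_eq_square algebra_simps)
    then show ?thesis by (rule key)
  qed
qed

section \<open>Evaluation of the local densities\<close>

lemma wdens_eqI:
  assumes "(\<lambda>k. real (rep_count d (p ^ k)) / real p ^ k) \<longlonglongrightarrow> w"
  shows "wdens d p = w"
  unfolding wdens_def using assms by (intro limI) (simp add: rep_count_def rep_mod_def)

lemma rep_density_recurrence:
  assumes "0 < c" "0 < m" "c dvd m" "U \<subseteq> {0..<m}" "\<And>r. r \<in> U \<Longrightarrow> \<not> c dvd r" "m dvd c * q" "0 < q"
    and "\<And>b. rep_mod d (c * q) (c * b) \<longleftrightarrow> rep_mod d' q b"
    and "\<And>a. \<not> c dvd a \<Longrightarrow> rep_mod d (c * q) a \<longleftrightarrow> a mod m \<in> U"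
  shows "real (rep_count d (c * q)) / real (c * q)
      = real (card U) / real m + 1 / real c * (real (rep_count d' q) / real q)"
proof -
  have "rep_count d (c * q) = c * q div m * card U + rep_count d' q"
    using assms by (intro rep_count_step) auto
  moreover have "real (c * q div m) = real (c * q) / real m" by (rule real_of_nat_div) fact
  ultimately show ?thesis using assms(1,2,7) by (simp add: field_simps)
qed

text \<open>The density satisfies the affine recurrence with constant card U / m and ratio 1/p. The
  threshold \<open>K\<close> passes over the small exponents at which m need not yet divide the
  modulus.\<close>

lemma rep_density_limit:
  assumes c: "1 < p" and m: "0 < m" "p dvd m" "U \<subseteq> {0..<m}" "\<And>r. r \<in> U \<Longrightarrow> \<not> p dvd r"
    and "\<And>k. k \<ge> K \<Longrightarrow> m dvd p ^ Suc k"
    and "\<And>k b. rep_mod d (p * p ^ k) (p * b) \<longleftrightarrow> rep_mod d (p ^ k) b"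
    and "\<And>k a. k \<ge> K \<Longrightarrow> \<not> p dvd a \<Longrightarrow> rep_mod d (p ^ Suc k) a \<longleftrightarrow> a mod m \<in> U"
  shows "(\<lambda>k. real (rep_count d (p ^ k)) / real p ^ k) \<longlonglongrightarrow> real (card U) / real m / (1 - 1 / real p)"
proof (rule affine_recurrence_tendsto)
  fix k assume "k \<ge> K"
  then have "real (rep_count d (p * p ^ k)) / real (p * p ^ k)
      = real (card U) / real m + 1 / real p * (real (rep_count d (p ^ k)) / real (p ^ k))"
    using assms by (intro rep_density_recurrence) auto
  then show "real (rep_count d (p ^ Suc k)) / real p ^ Suc k
      = real (card U) / real m + 1 / real p * (real (rep_count d (p ^ k)) / real p ^ k)" by simp
qed (use c in auto)

lemma dvd_4_pow: "k \<ge> 1 \<Longrightarrow> 4 dvd (2::nat) ^ Suc k"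
  using le_imp_power_dvd[of 2 "Suc k" "2::nat"] by simp

text \<open>Kept as a limit, since the density for d = 4 is computed from this sequence as
  well.\<close>

lemma rep_density_1_2: "(\<lambda>k. real (rep_count 1 (2 ^ k)) / 2 ^ k) \<longlonglongrightarrow> 1 / 2"
proof -
  have "(\<lambda>k. real (rep_count 1 (2 ^ k)) / real 2 ^ k) \<longlonglongrightarrow> real (card {1::nat}) / real 4 / (1 - 1 / real 2)"
  proof (rule rep_density_limit[where K = 1])
    show "rep_mod 1 (2 ^ Suc k) a \<longleftrightarrow> a mod 4 \<in> {1}" if "k \<ge> 1" "\<not> 2 dvd a" for k a
      using rep_mod_odd_1_4[of 1 "Suc k" a] that by simp
  qed (auto intro: dvd_4_pow simp: rep_mod_scale_1_2[simplified] simp del: power_Suc)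
  then show ?thesis by simp
qed

lemma wdens_1_2: "wdens 1 2 = 1 / 2"
  by (rule wdens_eqI) (use rep_density_1_2 in simp)

lemma wdens_2_2: "wdens 2 2 = 1 / 2"
proof (rule wdens_eqI)
  have "(\<lambda>k. real (rep_count 2 (2 ^ k)) / real 2 ^ k) \<longlonglongrightarrow> real (card {1, 3::nat}) / real 8 / (1 - 1 / real 2)"
  proof (rule rep_density_limit[where K = 2])
    show "rep_mod 2 (2 ^ Suc k) a \<longleftrightarrow> a mod 8 \<in> {1, 3}" if "k \<ge> 2" "\<not> 2 dvd a" for k a
      using rep_mod_odd_2[of "Suc k" a] that by simp
    show "8 dvd (2::nat) ^ Suc k" if "k \<ge> 2" for k
      using le_imp_power_dvd[of 3 "Suc k" "2::nat"] that by simp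
  qed (auto simp: rep_mod_scale_prime)
  then show "(\<lambda>k. real (rep_count 2 (2 ^ k)) / real 2 ^ k) \<longlonglongrightarrow> 1 / 2" by simp
qed

lemma wdens_3_3: "wdens 3 3 = 1 / 2"
proof (rule wdens_eqI)
  have "(\<lambda>k. real (rep_count 3 (3 ^ k)) / real 3 ^ k) \<longlonglongrightarrow> real (card {1::nat}) / real 3 / (1 - 1 / real 3)"
  proof (rule rep_density_limit[where K = 0])
    show "rep_mod 3 (3 ^ Suc k) a \<longleftrightarrow> a mod 3 \<in> {1}" if "\<not> 3 dvd a" for k a
    proof -
      have a: "\<not> [int a = 0] (mod 3)" using that by (simp add: cong_0_iff) presburger
      have "rep_mod 3 (3 ^ Suc k) a \<longleftrightarrow> Legendre (int a) 3 = 1"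
        using rep_mod_unit_odd_prime[of 3 "Suc k" a] that QuadRes_iff_Legendre[OF a] by simp
      also have "\<dots> \<longleftrightarrow> a mod 3 \<in> {1}"
        by (simp add: Legendre_mod_3 zmod_int[symmetric, of a 3, simplified])
      finally show ?thesis .
    qed
  qed (auto simp: rep_mod_scale_prime)
  then show "(\<lambda>k. real (rep_count 3 (3 ^ k)) / real 3 ^ k) \<longlonglongrightarrow> 1 / 2" by simp
qed

lemma wdens_7_7: "wdens 7 7 = 1 / 2"
proof (rule wdens_eqI)
  have "(\<lambda>k. real (rep_count 7 (7 ^ k)) / real 7 ^ k) \<longlonglongrightarrow> real (card {1, 2, 4::nat}) / real 7 / (1 - 1 / real 7)"
  proof (rule rep_density_limit[where K = 0])
    show "rep_mod 7 (7 ^ Suc k) a \<longleftrightarrow> a mod 7 \<in> {1, 2, 4}" if "\<not> 7 dvd a" for k a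
    proof -
      have a: "\<not> [int a = 0] (mod 7)" using that by (simp add: cong_0_iff) presburger
      have "rep_mod 7 (7 ^ Suc k) a \<longleftrightarrow> Legendre (int a) 7 = 1"
        using rep_mod_unit_odd_prime[of 7 "Suc k" a] that QuadRes_iff_Legendre[OF a] by simp
      also have "\<dots> \<longleftrightarrow> a mod 7 \<in> {1, 2, 4}"
        by (simp add: Legendre_mod_7 zmod_int[symmetric, of a 7, simplified])
      finally show ?thesis .
    qed
  qed (auto simp: rep_mod_scale_prime)
  then show "(\<lambda>k. real (rep_count 7 (7 ^ k)) / real 7 ^ k) \<longlonglongrightarrow> 1 / 2" by simp
qed

text \<open>Residues 2 and 3 modulo 4 are not represented, the class 1 contributes 1/4, and
  multiples of 4 contribute a quarter of the density 1/2 for d = 1.\<close>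

lemma wdens_4_2: "wdens 4 2 = 3 / 8"
proof (rule wdens_eqI)
  have rec: "real (rep_count 4 (4 * 2 ^ k)) / real (4 * 2 ^ k)
      = real (card {1::nat}) / real 4 + 1 / real 4 * (real (rep_count 1 (2 ^ k)) / real (2 ^ k))" for k
  proof (rule rep_density_recurrence)
    fix a :: nat assume a: "\<not> 4 dvd a"
    show "rep_mod 4 (4 * 2 ^ k) a \<longleftrightarrow> a mod 4 \<in> {1}"
    proof (cases "odd a")
      case True
      have "(4::nat) * 2 ^ k = 2 ^ (k + 2)" by (simp add: power_add)
      then show ?thesis using rep_mod_odd_1_4[of 4 "k + 2" a] True by simp
    next
      case False
      have "\<not> rep_mod 4 (4 * 2 ^ k) a"
      proof
        assume "rep_mod 4 (4 * 2 ^ k) a"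
        then obtain x y :: int where xy: "int (a mod 4) = (x^2 mod int 4 + int 4 * (y^2 mod int 4)) mod int 4"
          by (rule rep_mod_imp_mod_eq[where m = 4]) auto
        have "int (a mod 4) \<in> {0, 1}"
          unfolding xy using square_mod_4[of x] square_mod_4[of y] by auto
        then have "a mod 4 = 0 \<or> a mod 4 = 1" by auto
        with a False show False by presburger
      qed
      moreover have "a mod 4 \<noteq> 1" using False by presburger
      ultimately show ?thesis by simp
    qed
  qed (auto simp: rep_mod_scale_4)
  have "(\<lambda>k. real (card {1::nat}) / real 4 + 1 / real 4 * (real (rep_count 1 (2 ^ k)) / 2 ^ k))
      \<longlonglongrightarrow> real (card {1::nat}) / real 4 + 1 / real 4 * (1 / 2)"
    by (intro tendsto_intros rep_density_1_2)
  then have "(\<lambda>k. real (rep_count 4 (4 * 2 ^ k)) / real (4 * 2 ^ k)) \<longlonglongrightarrow> 3 / 8"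
    unfolding rec by simp
  then have "(\<lambda>k. real (rep_count 4 (2 ^ (k + 2))) / real 2 ^ (k + 2)) \<longlonglongrightarrow> 3 / 8"
    by (simp add: power_add mult.commute)
  then show "(\<lambda>k. real (rep_count 4 (2 ^ k)) / real 2 ^ k) \<longlonglongrightarrow> 3 / 8"
    by (rule LIMSEQ_offset)
qed

lemma wdens_7_2: "wdens 7 2 = 3 / 4"
proof (rule wdens_eqI, rule Lim_transform_eventually[OF tendsto_const])
  show "eventually (\<lambda>k. 3 / 4 = real (rep_count 7 (2 ^ k)) / real 2 ^ k) sequentially"
    using eventually_ge_at_top[of 2]
  proof eventually_elim
    case (elim k)
    have dvd: "4 dvd (2::nat) ^ k" using le_imp_power_dvd[OF elim, of "2::nat"] by simp
    have "rep_count 7 (2 ^ k) = card {a\<in>{0..<2^k}. a mod 4 \<in> {0, 1, 3::nat}}"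
      unfolding rep_count_def by (simp only: rep_mod_7_power_2[OF elim])
    also have "\<dots> = 2 ^ k div 4 * card {0, 1, 3::nat}"
      using dvd by (intro card_residue_classes) auto
    finally have "real (rep_count 7 (2 ^ k)) = real (2 ^ k div 4) * 3" by simp
    also have "real (2 ^ k div 4) = 2 ^ k / 4" using real_of_nat_div[OF dvd] by simp
    finally show ?case by simp
  qed
qed

section \<open>The limit\<close>

lemma odd_char_even: "even n \<Longrightarrow> odd_char d n = 0"
proof -
  assume "even n"
  moreover have "2 dvd odd_char_modulus d" by (simp add: odd_char_modulus_def)
  ultimately have "even (n mod odd_char_modulus d)" by (simp add: dvd_mod)
  moreover have "even r \<Longrightarrow> odd_char_table d r = 0" for r by (auto simp: odd_char_table_def)
  ultimately show ?thesis unfolding odd_char_def by blast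
qed

lemma odd_char_sum_real_bound:
  assumes "d \<in> {1, 2, 3, 4, 7}"
  shows "\<bar>\<Sum>k<n. real_of_int (odd_char d k)\<bar> \<le> (if d = 2 then 2 else 1)"
proof -
  have "real_of_int \<bar>\<Sum>k<n. odd_char d k\<bar> \<le> real_of_int (if d = 2 then 2 else 1)"
    using sum_odd_char_bound[OF assms] by (simp only: of_int_le_iff)
  then show ?thesis by (simp split: if_splits)
qed

lemma Lval_eq:
  assumes "d \<in> {1, 2, 3, 4, 7}"
  shows "Lval d = (\<Sum>n. real_of_int (odd_char d n) / real n)"
  unfolding Lval_def
  by (intro suminf_cong) (simp add: Jacobi_eq_odd_char[OF assms] odd_char_even)

text \<open>A short partial sum already exceeds the tail bound. The comparisons are 1 > 2/3 for d =
  1 and 4, 4/3 > 4/5 for d = 2, 1 > 2/5 for d = 3, and 2/3 > 1/2 for d = 7.\<close>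

lemma Lval_pos:
  assumes d: "d \<in> {1, 2, 3, 4, 7}"
  shows "Lval d > 0"
proof -
  have approx: "\<bar>Lval d - (\<Sum>n<m. real_of_int (odd_char d n) / real n)\<bar>
      \<le> 2 * (if d = 2 then 2 else 1) / real m" if "m \<ge> 1" for m
    unfolding Lval_eq[OF d] by (rule character_series(2)[OF odd_char_sum_real_bound[OF d] that])
  have pos: "Lval d > 0"
    if "(\<Sum>n<m. real_of_int (odd_char d n) / real n) = S" "m \<ge> 1" "2 * (if d = 2 then 2 else 1) / real m < S" for m S
    using approx[OF that(2)] that(1,3) by linarith
  note eval = odd_char_def odd_char_table_def odd_char_modulus_def lessThan_nat_numeral lessThan_Suc
  consider "d = 1 \<or> d = 4" | "d = 2" | "d = 3" | "d = 7" using d by auto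
  then show ?thesis
  proof cases
    case 1
    then have "(\<Sum>n<3. real_of_int (odd_char d n) / real n) = 1" by (auto simp: eval)
    from pos[OF this] show ?thesis using 1 by auto
  next
    case 2
    then have "(\<Sum>n<5. real_of_int (odd_char d n) / real n) = 4 / 3" by (simp add: eval)
    from pos[OF this] show ?thesis using 2 by auto
  next
    case 3
    then have "(\<Sum>n<5. real_of_int (odd_char d n) / real n) = 1" by (simp add: eval)
    from pos[OF this] show ?thesis using 3 by auto
  next
    case 4
    then have "(\<Sum>n<4. real_of_int (odd_char d n) / real n) = 2 / 3" by (simp add: eval)
    from pos[OF this] show ?thesis using 4 by auto
  qed
qed

section \<open>Comparison of the product over Q with the two Euler products\<close>

lemma odd_char_euler_product:
  assumes d: "d \<in> {1, 2, 3, 4, 7}"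
  shows "(\<lambda>N. \<Prod>p\<in>{p. prime p \<and> p \<le> N}. 1 - real_of_int (odd_char d p) / real p) \<longlonglongrightarrow> 1 / Lval d"
  unfolding Lval_eq[OF d]
proof (rule euler_product_at_1[OF _ _ _ _ odd_char_sum_real_bound[OF d]])
  show "\<bar>real_of_int (odd_char d n)\<bar> \<le> 1" for n
    using abs_odd_char_le[of d n] by linarith
  show "0 < (\<Sum>n. real_of_int (odd_char d n) / real n)"
    using Lval_pos[OF d] unfolding Lval_eq[OF d] .
qed (simp_all only: odd_char_mult[OF d] odd_char_0 odd_char_1 of_int_mult of_int_0 of_int_1)

lemma odd_char_odd_prime:
  assumes d: "d \<in> {1, 2, 3, 4, 7}" and p: "prime p" "odd p"
  shows "inQ d p \<longleftrightarrow> odd_char d p = -1" and "p dvd 2 * d \<longleftrightarrow> odd_char d p = 0"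
proof -
  have not2: "\<not> p dvd 2" using p by (metis even_iff_mod_2_eq_zero primes_dvd_imp_eq two_is_prime_nat dvd_refl)
  have "p dvd 2 * d \<longleftrightarrow> p dvd d" using p(1) not2 by (simp add: prime_dvd_mult_iff)
  also have "\<dots> \<longleftrightarrow> d = 3 \<and> 3 dvd p \<or> d = 7 \<and> 7 dvd p"
  proof -
    have "prime (3::nat)" "prime (7::nat)" by simp_all
    then have "p dvd 3 \<longleftrightarrow> 3 dvd p" "p dvd 7 \<longleftrightarrow> 7 dvd p"
      using p(1) primes_dvd_imp_eq by blast+
    moreover have "\<not> p dvd 4"
      using not2 p(1) prime_dvd_mult_iff[of p 2 2] by simp
    moreover have "\<not> p dvd 1" using p(1) by auto
    ultimately show ?thesis using d not2 by auto
  qed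
  finally have dvd: "p dvd 2 * d \<longleftrightarrow> d = 3 \<and> 3 dvd p \<or> d = 7 \<and> 7 dvd p" .
  have "(inQ d p \<longleftrightarrow> odd_char d p = -1) \<and> ((d = 3 \<and> 3 dvd p \<or> d = 7 \<and> 7 dvd p) \<longleftrightarrow> odd_char d p = 0)"
  proof -
    define r where "r = p mod odd_char_modulus d"
    have r2: "r mod 2 = 1"
    proof -
      have "2 dvd odd_char_modulus d" by (simp add: odd_char_modulus_def)
      then show ?thesis using p(2) unfolding r_def odd_iff_mod_2_eq_one by (simp add: mod_mod_cancel)
    qed
    have rc: "r \<in> {..<odd_char_modulus d}" by (simp add: r_def odd_char_modulus_def)
    consider "d = 1 \<or> d = 4" | "d = 2" | "d = 3" | "d = 7" using d by auto
    then show ?thesis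
    proof cases
      case 1
      then have c: "odd_char_modulus d = 4" by (auto simp: odd_char_modulus_def)
      have "r \<in> {1, 3}" using rc r2 unfolding c residue_ranges by auto
      moreover have "p mod 4 = r" by (simp add: r_def c)
      ultimately show ?thesis using 1 p(1) unfolding inQ_def odd_char_def c
        by (auto simp: odd_char_table_def)
    next
      case 2
      then have c: "odd_char_modulus d = 8" by (auto simp: odd_char_modulus_def)
      have "r \<in> {1, 3, 5, 7}" using rc r2 unfolding c residue_ranges by auto
      moreover have "p mod 8 = r" by (simp add: r_def c)
      ultimately show ?thesis using 2 p(1) unfolding inQ_def odd_char_def c
        by (auto simp: odd_char_table_def)
    next
      case 3
      then have c: "odd_char_modulus d = 6" by (auto simp: odd_char_modulus_def)
      have "r \<in> {1, 3, 5}" using rc r2 unfolding c residue_ranges by auto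
      moreover have "p mod 6 = r" by (simp add: r_def c)
      moreover have "p mod 3 = r mod 3" by (simp add: r_def c mod_mod_cancel)
      ultimately show ?thesis using 3 p(1) unfolding inQ_def odd_char_def c dvd_eq_mod_eq_0
        by (auto simp: odd_char_table_def)
    next
      case 4
      then have c: "odd_char_modulus d = 14" by (auto simp: odd_char_modulus_def)
      have "r \<in> {1, 3, 5, 7, 9, 11, 13}" using rc r2 unfolding c residue_ranges by auto
      moreover have "p mod 14 = r" by (simp add: r_def c)
      moreover have "p mod 7 = r mod 7" by (simp add: r_def c mod_mod_cancel)
      ultimately show ?thesis using 4 p(1) unfolding inQ_def odd_char_def c dvd_eq_mod_eq_0
        by (auto simp: odd_char_table_def)
    qed
  qed
  with dvd show "inQ d p \<longleftrightarrow> odd_char d p = -1" and "p dvd 2 * d \<longleftrightarrow> odd_char d p = 0" by simp_all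
qed

definition gfactor :: "nat \<Rightarrow> nat \<Rightarrow> real" where
  "gfactor d p = (if inQ d p \<and> odd p then (1 - inverse (real p ^ 2)) powr (-1/2) else 1)"

text \<open>The logarithm of each factor is at most p^(-2) in absolute value, because y / (1 - y)
  \<le> 2 y for y \<le> 1/4. Exponentiating the convergent sum gives both the limit and its
  positivity.\<close>

lemma gconst_tendsto: "(\<lambda>N. \<Prod>p\<le>N. gfactor d p) \<longlonglongrightarrow> gconst d" and gconst_pos: "gconst d > 0"
proof -
  define t where "t p = (if inQ d p \<and> odd p then - (1 / 2) * ln (1 - inverse (real p ^ 2)) else 0)" for p
  have x: "0 < inverse (real p ^ 2)" "inverse (real p ^ 2) \<le> 1 / 4" if "inQ d p" for p
  proof -
    have p: "p \<ge> 2" using that by (auto simp: inQ_def prime_ge_2_nat)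
    then show "0 < inverse (real p ^ 2)" by simp
    have "2 ^ 2 \<le> real p ^ 2" using p by (intro power_mono) auto
    then have "inverse (real p ^ 2) \<le> inverse (2 ^ 2)" by (rule le_imp_inverse_le) simp
    then show "inverse (real p ^ 2) \<le> 1 / 4" by simp
  qed
  have g: "gfactor d p = exp (t p)" for p
    using x[of p] by (auto simp: gfactor_def t_def powr_def)
  have "norm (t p) \<le> inverse (real p ^ 2)" for p
  proof (cases "inQ d p \<and> odd p")
    case True
    define y where "y = inverse (real p ^ 2)"
    have y: "0 < y" "y \<le> 1 / 4" using x True by (auto simp: y_def)
    have "- ln (1 - y) = ln (1 / (1 - y))" using y by (simp add: ln_div)
    also have "\<dots> \<le> 1 / (1 - y) - 1" using y by (intro ln_le_minus_one) auto
    also have "\<dots> = y / (1 - y)" using y by (simp add: field_simps)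
    also have "\<dots> \<le> y / (1 / 2)" using y by (intro divide_left_mono) auto
    finally have "- ln (1 - y) \<le> 2 * y" by simp
    moreover have "ln (1 - y) \<le> 0" using y by simp
    ultimately have "\<bar>- (1 / 2) * ln (1 - y)\<bar> \<le> y" by simp
    then show ?thesis using True by (simp add: t_def y_def)
  qed (auto simp: t_def)
  then have t: "summable t"
    by (intro summable_comparison_test'[OF inverse_power_summable[of 2, where 'a = real], of 0]) auto
  have conv: "convergent_prod (gfactor d)" unfolding g by (rule convergent_prod_exp[OF t])
  have G: "gconst d = prodinf (gfactor d)" unfolding gconst_def gfactor_def ..
  show "(\<lambda>N. \<Prod>p\<le>N. gfactor d p) \<longlonglongrightarrow> gconst d" unfolding G by (rule convergent_prod_LIMSEQ[OF conv])
  show "gconst d > 0" unfolding G g prodinf_exp[OF t] by simp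
qed

text \<open>For character value -1 and x = 1/p this is (1 + x) (1 + x)^(-2) (1 - x^2) = 1 - x.
  Otherwise p is outside the odd part of Q, and a vanishing character means that p divides 2d; this
  includes p = 2.\<close>

lemma one_minus_inverse_factorization:
  assumes d: "d \<in> {1, 2, 3, 4, 7}" and p: "prime p"
  shows "1 - 1 / real p = (1 - real_of_int (odd_char d p) / real p)
    * (if p dvd 2 * d then 1 - 1 / real p else 1)
    * ((if inQ d p \<and> odd p then inverse (1 + inverse (real p)) else 1) / gfactor d p) ^ 2"
proof (cases "odd p")
  case False
  then have "p = 2" using p primes_dvd_imp_eq[of 2 p] by simp
  then show ?thesis by (simp add: odd_char_even gfactor_def)
next
  case True
  note kro = odd_char_odd_prime[OF d p True]
  have "odd_char d p = -1 \<or> odd_char d p = 0 \<or> odd_char d p = 1"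
    using abs_odd_char_le[of d p] by linarith
  then consider "odd_char d p = -1" | "odd_char d p = 0 \<or> odd_char d p = 1" by blast
  then show ?thesis
  proof cases
    case 1
    define x where "x = 1 / real p"
    have x: "0 < x" "x < 1" using prime_gt_1_nat[OF p] by (auto simp: x_def)
    have "x * x < 1 * 1" using x by (intro mult_strict_mono) auto
    then have sq: "1 - x\<^sup>2 > 0" by (simp add: power2_eq_square)
    have "gfactor d p = (1 - x\<^sup>2) powr (-1/2)"
      using 1 kro True by (simp add: gfactor_def x_def power_divide inverse_eq_divide)
    then have "gfactor d p ^ 2 = (1 - x\<^sup>2) powr (-1)"
      using sq by (simp add: power2_eq_square powr_add[symmetric])
    then have gf: "gfactor d p ^ 2 = inverse (1 - x\<^sup>2)"
      using sq by (simp add: powr_minus)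
    have "u * (inverse u ^ 2 / inverse (u * v)) = v" if "u \<noteq> 0" "v \<noteq> 0" for u v :: real
      using that by (simp add: field_simps power2_eq_square)
    from this[of "1 + x" "1 - x"]
    have "(1 + x) * (inverse (1 + x) ^ 2 / inverse (1 - x\<^sup>2)) = 1 - x"
      using x by (simp add: power2_eq_square algebra_simps)
    then have "(1 + x) * (inverse (1 + x) / gfactor d p) ^ 2 = 1 - x"
      unfolding power_divide gf .
    moreover have "inverse (real p) = x" "1 / real p = x" by (simp_all add: x_def inverse_eq_divide)
    moreover have "inQ d p" "\<not> p dvd 2 * d" using 1 kro by auto
    ultimately show ?thesis using 1 True by simp
  next
    case 2
    then have "\<not> inQ d p" using kro by auto
    with 2 kro show ?thesis by (auto simp: gfactor_def)
  qed
qed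

lemma prod_prime_divisors:
  assumes "0 < m" "m \<le> N"
  shows "(\<Prod>p\<in>{p. prime p \<and> p \<le> N}. if p dvd m then 1 - 1 / real p else 1) = real (totient m) / real m"
proof -
  have "(\<Prod>p\<in>{p. prime p \<and> p \<le> N}. if p dvd m then 1 - 1 / real p else 1)
      = (\<Prod>p\<in>prime_factors m. 1 - 1 / real p)"
    using assms dvd_imp_le[of _ m]
    by (intro prod.mono_neutral_cong_right) (auto simp: prime_factors_dvd intro: order_trans)
  then show ?thesis using assms(1) by (simp add: totient_formula2)
qed

text \<open>Indexed by all primes up to N with default factor 1, to match the other products factor
  by factor. The prime 2, which belongs to Q for d = 3 although its character value is 0, is left
  out and restored later.\<close>

definition odd_Q_product :: "nat \<Rightarrow> nat \<Rightarrow> real" where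
  "odd_Q_product d N = (\<Prod>p\<in>{p. prime p \<and> p \<le> N}. if inQ d p \<and> odd p then inverse (1 + inverse (real p)) else 1)"

lemma odd_Q_product_pos: "odd_Q_product d N > 0"
  unfolding odd_Q_product_def by (intro prod_pos) (auto simp: add_pos_nonneg)

text \<open>Multiplying the factorization over primes and solving for the product over Q leaves a
  square root of Mertens' product divided by the Euler product of the character and by the totient
  ratio.\<close>

lemma odd_Q_product_asymptotics:
  assumes d: "d \<in> {1, 2, 3, 4, 7}"
  shows "(\<lambda>N. odd_Q_product d N * sqrt (ln (real N)))
    \<longlonglongrightarrow> gconst d * sqrt (exp (- euler_mascheroni) * Lval d * real (2 * d) / real (totient (2 * d)))"
proof -
  define A where "A N = (\<Prod>p\<in>{p. prime p \<and> p \<le> N}. 1 - 1 / real p)" for N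
  define E where "E N = (\<Prod>p\<in>{p. prime p \<and> p \<le> N}. 1 - real_of_int (odd_char d p) / real p)" for N
  define H where "H N = (\<Prod>p\<le>N. gfactor d p)" for N
  define \<tau> where "\<tau> = real (totient (2 * d)) / real (2 * d)"
  have d0: "d > 0" "d \<le> 7" using d by auto
  have \<tau>: "\<tau> > 0" using d0 by (simp add: \<tau>_def)
  have L: "Lval d > 0" by (rule Lval_pos[OF d])
  have gpos: "gfactor d p > 0" for p
  proof (cases "inQ d p \<and> odd p")
    case True
    then have "real p ^ 2 > 1" using prime_gt_1_nat[of p] by (simp add: inQ_def)
    then show ?thesis by (simp add: gfactor_def)
  qed (auto simp: gfactor_def)
  have H: "H N = (\<Prod>p\<in>{p. prime p \<and> p \<le> N}. gfactor d p)" for N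
    unfolding H_def by (rule prod.mono_neutral_right) (auto simp: gfactor_def inQ_def)
  have Hpos: "H N > 0" for N unfolding H_def by (intro prod_pos) (auto simp: gpos)
  have Epos: "E N > 0" for N
  proof -
    have "real_of_int (odd_char d p) / real p < 1" if "prime p" for p
    proof -
      have "real_of_int (odd_char d p) \<le> 1" using abs_odd_char_le[of d p] by linarith
      then show ?thesis using prime_gt_1_nat[OF that] by (simp add: field_simps)
    qed
    then show ?thesis unfolding E_def by (intro prod_pos) auto
  qed
  \<comment> \<open>Since 2d is at most 14, all its prime divisors then occur in the range, and the
    totient factor is complete.\<close>
  have fac: "A N = E N * \<tau> * (odd_Q_product d N / H N) ^ 2" if "N \<ge> 14" for N
  proof -
    have "A N = (\<Prod>p\<in>{p. prime p \<and> p \<le> N}. (1 - real_of_int (odd_char d p) / real p)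
        * (if p dvd 2 * d then 1 - 1 / real p else 1)
        * ((if inQ d p \<and> odd p then inverse (1 + inverse (real p)) else 1) / gfactor d p) ^ 2)"
      unfolding A_def by (intro prod.cong refl one_minus_inverse_factorization[OF d]) auto
    also have "\<dots> = E N * (\<Prod>p\<in>{p. prime p \<and> p \<le> N}. if p dvd 2 * d then 1 - 1 / real p else 1)
        * (odd_Q_product d N / H N) ^ 2"
      unfolding E_def H odd_Q_product_def prod.distrib prod_power_distrib[symmetric] prod_dividef ..
    also have "(\<Prod>p\<in>{p. prime p \<and> p \<le> N}. if p dvd 2 * d then 1 - 1 / real p else 1) = \<tau>"
      unfolding \<tau>_def using that d0 by (intro prod_prime_divisors) auto
    finally show ?thesis .
  qed
  have "(\<lambda>N. H N * sqrt ((A N * ln (real N)) / (E N * \<tau>)))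
      \<longlonglongrightarrow> gconst d * sqrt (exp (- euler_mascheroni) / (1 / Lval d * \<tau>))"
    unfolding H_def A_def E_def using L \<tau>
    by (intro tendsto_intros gconst_tendsto mertens_third odd_char_euler_product d) auto
  moreover have "eventually (\<lambda>N. H N * sqrt ((A N * ln (real N)) / (E N * \<tau>))
      = odd_Q_product d N * sqrt (ln (real N))) sequentially"
    using eventually_ge_at_top[of 14]
  proof eventually_elim
    case (elim N)
    have "(A N * ln (real N)) / (E N * \<tau>) = (odd_Q_product d N / H N) ^ 2 * ln (real N)"
      using Epos[of N] \<tau> by (simp add: fac[OF elim])
    then have "sqrt ((A N * ln (real N)) / (E N * \<tau>)) = odd_Q_product d N / H N * sqrt (ln (real N))"
      using odd_Q_product_pos[of d N] Hpos[of N] by (simp add: real_sqrt_mult)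
    then show ?case using Hpos[of N] by simp
  qed
  ultimately have "(\<lambda>N. odd_Q_product d N * sqrt (ln (real N)))
      \<longlonglongrightarrow> gconst d * sqrt (exp (- euler_mascheroni) / (1 / Lval d * \<tau>))"
    by (rule Lim_transform_eventually)
  then show ?thesis by (simp add: \<tau>_def mult.assoc)
qed

text \<open>The only even prime in any of the sets is 2 for d = 3, and its factor is 1 / (1 + 1/2) =
  2/3.\<close>

lemma Q_product_eq:
  assumes d: "d \<in> {1, 2, 3, 4, 7}" and "N \<ge> 2"
  shows "(\<Prod>p\<in>{p. inQ d p \<and> p \<le> N}. inverse (1 + inverse (real p)))
    = (if d = 3 then 2 / 3 else 1) * odd_Q_product d N"
proof -
  have odd: "odd_Q_product d N = (\<Prod>p\<in>{p. inQ d p \<and> p \<le> N \<and> odd p}. inverse (1 + inverse (real p)))"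
    unfolding odd_Q_product_def by (rule prod.mono_neutral_cong_right) (auto simp: inQ_def)
  show ?thesis
  proof (cases "d = 3")
    case True
    have "{p. inQ d p \<and> p \<le> N} = insert 2 {p. inQ d p \<and> p \<le> N \<and> odd p}"
    proof -
      have "inQ d 2" using True by (simp add: inQ_def)
      moreover have "p = 2" if "inQ d p" "even p" for p
        using that primes_dvd_imp_eq[of 2 p] by (auto simp: inQ_def)
      ultimately show ?thesis using assms(2) by auto
    qed
    then have "(\<Prod>p\<in>{p. inQ d p \<and> p \<le> N}. inverse (1 + inverse (real p)))
        = inverse (1 + inverse (real 2)) * odd_Q_product d N"
      unfolding odd by (simp only:) (subst prod.insert, auto)
    then show ?thesis using True by simp
  next
    case False
    have "{p. inQ d p \<and> p \<le> N} = {p. inQ d p \<and> p \<le> N \<and> odd p}"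
    proof -
      have "odd p" if "inQ d p" for p
      proof
        assume "even p"
        then have "p = 2" using that primes_dvd_imp_eq[of 2 p] by (auto simp: inQ_def)
        with that False d show False by (auto simp: inQ_def)
      qed
      then show ?thesis by auto
    qed
    then show ?thesis using False unfolding odd by simp
  qed
qed

text \<open>This accounts for the constants \<open>delta\<close> and for the 1/2 in the limit: the
  densities, with the factor 2/3 of the prime 2 when d = 3, multiply to 1/2, 1/2, 1/3, 3/8, 3/8 for
  d = 1, 2, 3, 4, 7.\<close>

lemma local_factor:
  assumes "d \<in> {1, 2, 3, 4, 7}"
  shows "(\<Prod>p\<in>Rset d. wdens d p) * (if d = 3 then 2 / 3 else 1) = delta d / 2"
  using assms
  by (auto simp: Rset_def delta_def wdens_1_2[unfolded One_nat_def] wdens_2_2 wdens_3_3 wdens_4_2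
      wdens_7_2 wdens_7_7)

theorem theorem6p1:
  fixes d :: nat
  assumes "d \<in> {1, 2, 3, 4, 7}"
  shows "(\<lambda>n. Mfun d n / Lfun d n) \<longlonglongrightarrow> (1/2) * sqrt (pi / exp euler_mascheroni)"
proof -
  define t where "t = real (totient (2 * d))"
  define K where "K = sqrt (2 * real d * Lval d / (pi * t))"
  have d: "d > 0" using assms by auto
  have t: "t > 0" using d by (simp add: t_def)
  have L: "Lval d > 0" by (rule Lval_pos[OF assms])
  have K: "K > 0" using d t L by (simp add: K_def)
  have \<delta>: "delta d > 0" by (simp add: delta_def)
  have "(\<lambda>n. (1 / 2) * (odd_Q_product d n * sqrt (ln (real n))) / (gconst d * K))
      \<longlonglongrightarrow> (1 / 2) * (gconst d * sqrt (exp (- euler_mascheroni) * Lval d * real (2 * d) / t)) / (gconst d * K)"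
    unfolding t_def using K gconst_pos[of d]
    by (intro tendsto_intros odd_Q_product_asymptotics assms) auto
  also have "(1 / 2) * (gconst d * sqrt (exp (- euler_mascheroni) * Lval d * real (2 * d) / t)) / (gconst d * K)
      = (1 / 2) * (sqrt (exp (- euler_mascheroni) * Lval d * real (2 * d) / t) / K)"
    using gconst_pos[of d] by simp
  \<comment> \<open>The value of L, the factor 2d and the totient occur in both radicands and
    cancel, so the limit does not depend on d.\<close>
  also have "sqrt (exp (- euler_mascheroni) * Lval d * real (2 * d) / t) / K = sqrt (pi / exp euler_mascheroni)"
    unfolding K_def real_sqrt_divide[symmetric] using d t L by (simp add: exp_minus field_simps)
  finally have lim: "(\<lambda>n. (1 / 2) * (odd_Q_product d n * sqrt (ln (real n))) / (gconst d * K))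
      \<longlonglongrightarrow> (1 / 2) * sqrt (pi / exp euler_mascheroni)" .
  show ?thesis
  proof (rule Lim_transform_eventually[OF lim])
    show "eventually (\<lambda>n. (1 / 2) * (odd_Q_product d n * sqrt (ln (real n))) / (gconst d * K)
        = Mfun d n / Lfun d n) sequentially"
      using eventually_ge_at_top[of 2]
    proof eventually_elim
      case (elim n)
      have M: "Mfun d n = (delta d / 2) * odd_Q_product d n"
        unfolding Mfun_def Q_product_eq[OF assms elim] local_factor[OF assms, symmetric] by simp
      have "Lfun d n = delta d * gconst d * K / sqrt (ln (real n))"
        unfolding Lfun_def beta_def K_def t_def by simp
      then show ?case unfolding M using \<delta> by (simp add: field_simps)
    qed
  qed
qed

end
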